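(* Let $F_2=F(a,b)$ be the free group with free basis $\{a,b\}$. For all integers $n\ge 2$, $$d_{simp}(a^n b^n; F_2)=2.$$
   Context: A nontrivial element $g$ of a nonabelian free group $U$ is called simple in $U$ if it belongs to a proper free factor of $U$, i.e. there is a free product decomposition $U=U_1\ast U_2$ with $U_1\ne 1$, $U_2\ne 1$ and $g\in U_1$. For $1\ne g\in F_2$, the simplicity index $d_{simp}(g;F_2)$ is the smallest index $[F_2:H]$ of a finite-index subgroup $H\le F_2$ such that $g\in H$ and $g$ is simple in $H$ (such $H$ always exists). *)

theory Defs
  imports "HOL-Algebra.Algebra"
begin

definition list_prod :: "('g, 'm) monoid_scheme \<Rightarrow> 'g list \<Rightarrow> 'g" where
  "list_prod G xs = foldr (\<otimes>\<^bsub>G\<^esub>) xs \<one>\<^bsub>G\<^esub>"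

text \<open>A group word is a list of letters \<open>(x, e)\<close>, standing for \<open>x\<close> if \<open>e\<close> holds and for the
  inverse of \<open>x\<close> otherwise.\<close>

definition letter_val :: "('g, 'm) monoid_scheme \<Rightarrow> 'g \<times> bool \<Rightarrow> 'g" where
  "letter_val G l = (if snd l then fst l else inv\<^bsub>G\<^esub> (fst l))"

definition word_val :: "('g, 'm) monoid_scheme \<Rightarrow> ('g \<times> bool) list \<Rightarrow> 'g" where
  "word_val G w = list_prod G (map (letter_val G) w)"

definition reduced_word :: "('g \<times> bool) list \<Rightarrow> bool" where
  "reduced_word w \<longleftrightarrow> successively (\<lambda>l l'. fst l = fst l' \<longrightarrow> snd l = snd l') w"

text \<open>The universal property of a free group quantifies over groups on arbitrary types, which a
  HOL definition cannot do. Freeness is therefore expressed through reduced words.\<close>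

definition free_basis :: "('g, 'm) monoid_scheme \<Rightarrow> 'g set \<Rightarrow> bool" where
  "free_basis G S \<longleftrightarrow>
     S \<subseteq> carrier G \<and>
     generate G S = carrier G \<and>
     (\<forall>w. w \<noteq> [] \<longrightarrow> fst ` set w \<subseteq> S \<longrightarrow> reduced_word w \<longrightarrow> word_val G w \<noteq> \<one>\<^bsub>G\<^esub>)"

text \<open>\<open>U\<close> is the internal free product of \<open>U1\<close> and \<open>U2\<close>, expressed by the normal form for free
  products. The last condition also forces the two factors to intersect trivially: for a common
  element \<open>x\<close> other than the identity, the list consisting of \<open>x\<close> and its inverse is alternating.\<close>

definition internal_free_product :: "('g, 'm) monoid_scheme \<Rightarrow> 'g set \<Rightarrow> 'g set \<Rightarrow> bool" where
  "internal_free_product U U1 U2 \<longleftrightarrow>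
     subgroup U1 U \<and> subgroup U2 U \<and>
     generate U (U1 \<union> U2) = carrier U \<and>
     (\<forall>xs. xs \<noteq> [] \<longrightarrow> set xs \<subseteq> (U1 \<union> U2) - {\<one>\<^bsub>U\<^esub>} \<longrightarrow>
        successively (\<lambda>x y. (x \<in> U1 \<and> y \<in> U2) \<or> (x \<in> U2 \<and> y \<in> U1)) xs \<longrightarrow>
        list_prod U xs \<noteq> \<one>\<^bsub>U\<^esub>)"

text \<open>The notion is meant for nonabelian free groups \<open>U\<close>. Finite-index subgroups of a free group of
  rank two are of this kind, so the definition of the index below does not repeat the condition.\<close>

definition simple_in :: "('g, 'm) monoid_scheme \<Rightarrow> 'g \<Rightarrow> bool" where
  "simple_in U g \<longleftrightarrow>
     g \<noteq> \<one>\<^bsub>U\<^esub> \<and>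
     (\<exists>U1 U2. internal_free_product U U1 U2 \<and> U1 \<noteq> {\<one>\<^bsub>U\<^esub>} \<and> U2 \<noteq> {\<one>\<^bsub>U\<^esub>} \<and> g \<in> U1)"

definition simplicity_index :: "('g, 'm) monoid_scheme \<Rightarrow> 'g \<Rightarrow> nat" where
  "simplicity_index G g =
     (LEAST k. \<exists>H. subgroup H G \<and> finite (rcosets\<^bsub>G\<^esub> H) \<and> card (rcosets\<^bsub>G\<^esub> H) = k \<and>
        g \<in> H \<and> simple_in (G\<lparr>carrier := H\<rparr>) g)"

end

theory Submission imports Defs begin

text \<open>Index one: suppose \<open>F = U1 * U2\<close> with \<open>a\<^sup>nb\<^sup>n \<in> U1\<close> and \<open>U2\<close> nontrivial. The retraction
  \<open>\<rho>\<close> of \<open>F\<close> onto \<open>U2\<close> kills \<open>a\<^sup>nb\<^sup>n\<close>, so, roots in a free group being unique, \<open>\<rho> b\<close> is the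
  inverse of \<open>t = \<rho> a\<close> and \<open>U2\<close> is generated by \<open>t\<close>. Let \<open>\<chi>\<close> be the character to \<open>\<int>/n\<close> with
  \<open>a \<mapsto> 1\<close>, \<open>b \<mapsto> 0\<close>; it kills \<open>a\<^sup>nb\<^sup>n\<close>. If \<open>\<chi>\<close> were trivial on \<open>U1\<close>, it would factor through
  \<open>\<rho>\<close>, which contradicts \<open>\<chi> a + \<chi> b \<noteq> 0\<close>. Otherwise map \<open>F\<close> to the wreath product of \<open>\<int>/n\<close>
  by \<open>\<int>\<close>, sending \<open>U1\<close> by \<open>\<chi>\<close> to the copy of \<open>\<int>/n\<close> at position \<open>0\<close> and \<open>t\<close> to a nontrivial
  shift. As \<open>a\<^sup>nb\<^sup>n\<close> dies, the image of \<open>a\<^sup>n\<close> is central in the image of \<open>F\<close>; but it involves a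
  nontrivial shift, which moves the copy of \<open>\<int>/n\<close> at \<open>0\<close>.

  Index two: for odd \<open>m\<close> the elements \<open>a\<^sup>2\<close>, \<open>b\<^sup>2\<close>, \<open>a\<^sup>mb\<^sup>m\<close> freely generate the subgroup of index
  two that consists of the words of even length. If \<open>n\<close> is odd, then \<open>a\<^sup>nb\<^sup>n\<close> is the third basis
  element for \<open>m = n\<close>; if \<open>n\<close> is even, it lies in the free factor generated by \<open>a\<^sup>2\<close> and \<open>b\<^sup>2\<close>.\<close>

section \<open>Products of lists and words\<close>

lemma list_prod_Nil [simp]: "list_prod G [] = \<one>\<^bsub>G\<^esub>"
  by (simp add: list_prod_def)

lemma list_prod_Cons [simp]: "list_prod G (x # xs) = x \<otimes>\<^bsub>G\<^esub> list_prod G xs"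
  by (simp add: list_prod_def)

context group
begin

lemma list_prod_closed [simp]: "set xs \<subseteq> carrier G \<Longrightarrow> list_prod G xs \<in> carrier G"
  by (induction xs) auto

lemma list_prod_append:
  "set xs \<subseteq> carrier G \<Longrightarrow> set ys \<subseteq> carrier G \<Longrightarrow>
     list_prod G (xs @ ys) = list_prod G xs \<otimes> list_prod G ys"
  by (induction xs) (auto simp: m_assoc)

lemma list_prod_replicate: "x \<in> carrier G \<Longrightarrow> list_prod G (replicate k x) = x [^] k"
  proof (induction k)
  case (Suc k)
  then show ?case using nat_pow_Suc2[of x k] by simp
qed simp

lemma list_prod_remove_one:
  assumes "set us \<subseteq> carrier G" "set vs \<subseteq> carrier G"
  shows "list_prod G (us @ \<one> # vs) = list_prod G (us @ vs)"
  using assms by (simp add: list_prod_append)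

lemma list_prod_merge:
  assumes "set us \<subseteq> carrier G" "x \<in> carrier G" "y \<in> carrier G" "set vs \<subseteq> carrier G"
  shows "list_prod G (us @ x # y # vs) = list_prod G (us @ (x \<otimes> y) # vs)"
  using assms by (simp add: list_prod_append m_assoc)

lemma generate_eq_list_prod:
  assumes "S \<subseteq> carrier G" "\<And>x. x \<in> S \<Longrightarrow> inv x \<in> S" "x \<in> generate G S"
  shows "\<exists>xs. set xs \<subseteq> S \<and> list_prod G xs = x"
  using assms(3)
proof (induction rule: generate.induct)
  case one
  show ?case by (rule exI[of _ "[]"]) simp
next
  case (incl h)
  then show ?case using assms(1) by (intro exI[of _ "[h]"]) auto
next
  case (inv h)
  then show ?case using assms(1) assms(2)[of h] by (intro exI[of _ "[inv h]"]) auto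
next
  case (eng h1 h2)
  then obtain xs ys where "set xs \<subseteq> S" "list_prod G xs = h1" "set ys \<subseteq> S" "list_prod G ys = h2"
    by blast
  then show ?case using assms(1) by (intro exI[of _ "xs @ ys"]) (auto simp: list_prod_append)
qed

lemma letter_val_closed [simp]: "fst l \<in> carrier G \<Longrightarrow> letter_val G l \<in> carrier G"
  by (simp add: letter_val_def)

lemma word_val_Nil [simp]: "word_val G [] = \<one>"
  by (simp add: word_val_def)

lemma word_val_Cons [simp]: "word_val G (l # w) = letter_val G l \<otimes> word_val G w"
  by (simp add: word_val_def)

lemma word_val_closed [simp]: "fst ` set w \<subseteq> carrier G \<Longrightarrow> word_val G w \<in> carrier G"
  unfolding word_val_def by (rule list_prod_closed) auto

lemma word_val_append:
  "fst ` set u \<subseteq> carrier G \<Longrightarrow> fst ` set v \<subseteq> carrier G \<Longrightarrow>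
     word_val G (u @ v) = word_val G u \<otimes> word_val G v"
  unfolding word_val_def map_append by (rule list_prod_append) auto

lemma word_val_concat:
  assumes "\<And>w. w \<in> set ws \<Longrightarrow> fst ` set w \<subseteq> carrier G"
  shows "word_val G (concat ws) = list_prod G (map (word_val G) ws)"
  using assms
proof (induction ws)
  case (Cons w ws)
  have "fst ` set (concat ws) \<subseteq> carrier G" using Cons.prems by fastforce
  with Cons show ?case by (simp add: word_val_append)
qed simp

lemma word_val_replicate_concat:
  "fst ` set w \<subseteq> carrier G \<Longrightarrow> word_val G (concat (replicate k w)) = word_val G w [^] k"
  by (subst word_val_concat) (auto simp: list_prod_replicate)

end

section \<open>Inverse words and free reduction\<close>

definition inv_word :: "('a \<times> bool) list \<Rightarrow> ('a \<times> bool) list" where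
  "inv_word w = rev (map (apsnd Not) w)"

lemma inv_word_simps [simp]:
  "inv_word [] = []"
  "inv_word (u @ v) = inv_word v @ inv_word u"
  "inv_word (l # v) = inv_word v @ [apsnd Not l]"
  "length (inv_word w) = length w"
  "fst ` set (inv_word w) = fst ` set w"
  "inv_word (inv_word w) = w"
  "inv_word w = [] \<longleftrightarrow> w = []"
proof -
  have "apsnd Not (apsnd Not l) = l" for l :: "'a \<times> bool" by (cases l) simp
  then show "inv_word (inv_word w) = w" 
    by (auto simp: inv_word_def rev_map intro: map_idI)
qed (auto simp: inv_word_def image_image)

lemma reduced_word_inv_word [simp]: "reduced_word (inv_word w) \<longleftrightarrow> reduced_word w"
proof -
  have *: "(\<lambda>x y. fst (apsnd Not y) = fst (apsnd Not x) \<longrightarrow> snd (apsnd Not y) = snd (apsnd Not x))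
     = (\<lambda>l l' :: 'a \<times> bool. fst l = fst l' \<longrightarrow> snd l = snd l')"
    by (auto simp: fun_eq_iff)
  show ?thesis unfolding reduced_word_def inv_word_def successively_rev successively_map * ..
qed

lemma reduced_word_append_iff:
  "reduced_word (u @ v) \<longleftrightarrow> reduced_word u \<and> reduced_word v \<and>
     (u = [] \<or> v = [] \<or> (fst (last u) = fst (hd v) \<longrightarrow> snd (last u) = snd (hd v)))"
  by (auto simp: reduced_word_def successively_append_iff)

lemma reduced_word_Nil [simp]: "reduced_word []"
  by (simp add: reduced_word_def)

lemma reduced_word_Cons:
  "reduced_word (l # w) \<longleftrightarrow> w = [] \<or> ((fst l = fst (hd w) \<longrightarrow> snd l = snd (hd w)) \<and> reduced_word w)"
  by (simp add: reduced_word_def successively_Cons)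

lemma reduced_word_replicate: "reduced_word (replicate k l)"
  by (induction k) (auto simp: reduced_word_Cons)

lemma (in group) word_val_inv_word:
  "fst ` set w \<subseteq> carrier G \<Longrightarrow> word_val G (inv_word w) = inv (word_val G w)"
proof (induction w)
  case (Cons l w)
  have *: "letter_val G (apsnd Not l) = inv (letter_val G l)" using Cons.prems
    by (auto simp: letter_val_def)
  show ?case using Cons
    by (simp add: word_val_append * inv_mult_group)
qed simp

text \<open>The tail is reduced before the new letter is added, so each letter causes at most one
  cancellation.\<close>

fun reduce_word :: "('a \<times> bool) list \<Rightarrow> ('a \<times> bool) list" where
  "reduce_word [] = []"
| "reduce_word (l # w) = (case reduce_word w of [] \<Rightarrow> [l]
     | l' # w' \<Rightarrow> if fst l = fst l' \<and> snd l \<noteq> snd l' then w' else l # l' # w')"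

lemma reduced_word_reduce_word: "reduced_word (reduce_word w)"
  by (induction w) (auto simp: reduced_word_Cons split: list.splits)

lemma set_reduce_word: "set (reduce_word w) \<subseteq> set w"
  by (induction w) (auto split: list.splits)

text \<open>Stated for a substitution \<open>\<phi>\<close> of the letters, so that the same reduction computes values in
  two groups at once.\<close>

lemma (in group) word_val_reduce_word:
  assumes "\<phi> ` fst ` set w \<subseteq> carrier G"
  shows "word_val G (map (apfst \<phi>) (reduce_word w)) = word_val G (map (apfst \<phi>) w)"
  using assms
proof (induction w)
  case (Cons l w)
  then have IH: "word_val G (map (apfst \<phi>) (reduce_word w)) = word_val G (map (apfst \<phi>) w)" by auto
  show ?case
  proof (cases "reduce_word w")
    case Nil
    then show ?thesis using IH by simp
  next
    case (Cons l' w')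
    have w': "fst ` set (map (apfst \<phi>) (l' # w')) \<subseteq> carrier G"
      using set_reduce_word[of w] Cons Cons.prems by (auto simp: image_image)
    have l: "\<phi> (fst l) \<in> carrier G" using Cons.prems by simp
    show ?thesis
    proof (cases "fst l = fst l' \<and> snd l \<noteq> snd l'")
      case True
      have "letter_val G (apfst \<phi> l) \<otimes> letter_val G (apfst \<phi> l') = \<one>"
        using True l by (cases l; cases l') (auto simp: letter_val_def)
      moreover have "word_val G (map (apfst \<phi>) (l # w)) =
         letter_val G (apfst \<phi> l) \<otimes> (letter_val G (apfst \<phi> l') \<otimes> word_val G (map (apfst \<phi>) w'))"
        using IH Cons by simp
      moreover have "letter_val G (apfst \<phi> l) \<in> carrier G" using l by simp
      moreover have "word_val G (map (apfst \<phi>) w') \<in> carrier G" "letter_val G (apfst \<phi> l') \<in> carrier G"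
        using w' by (simp_all del: set_map)
      ultimately show ?thesis using Cons True by (simp add: m_assoc[symmetric])
    next
      case False
      then show ?thesis using IH Cons by auto
    qed
  qed
qed simp

lemma (in group) generate_reduced_word:
  assumes S: "S \<subseteq> carrier G" and x: "x \<in> generate G S"
  obtains w where "fst ` set w \<subseteq> S" "reduced_word w" "word_val G w = x"
proof -
  have "\<exists>w. fst ` set w \<subseteq> S \<and> word_val G w = x" using x
  proof (induction rule: generate.induct)
    case one
    show ?case by (rule exI[of _ "[]"]) simp
  next
    case (incl h)
    then show ?case using S by (intro exI[of _ "[(h, True)]"]) (auto simp: letter_val_def)
  next
    case (inv h)
    then show ?case using S by (intro exI[of _ "[(h, False)]"]) (auto simp: letter_val_def)
  next
    case (eng h1 h2)
    then obtain u v where uv: "fst ` set u \<subseteq> S" "word_val G u = h1" "fst ` set v \<subseteq> S" "word_val G v = h2"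
      by blast
    then have "word_val G (u @ v) = h1 \<otimes> h2"
      using word_val_append[OF subset_trans[OF _ S] subset_trans[OF _ S]] by metis
    moreover have "fst ` set (u @ v) \<subseteq> S" using uv by auto
    ultimately show ?case by blast
  qed
  then obtain w where w: "fst ` set w \<subseteq> S" "word_val G w = x" by blast
  have [simp]: "apfst (\<lambda>x :: 'a. x) = (\<lambda>l :: 'a \<times> bool. l)" by (auto simp: fun_eq_iff)
  have "word_val G (reduce_word w) = x"
    using word_val_reduce_word[of "\<lambda>x. x" w] w S by auto
  moreover have "fst ` set (reduce_word w) \<subseteq> S" using set_reduce_word[of w] w by blast
  ultimately show thesis using that reduced_word_reduce_word by blast
qed

section \<open>Extending maps to homomorphisms\<close>

text \<open>A von Dyck principle: \<open>f\<close> extends once every relation among the generators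
  \<open>v l\<close> holds in \<open>K\<close>. Words have no formal inverses; \<open>surj\<close>
  supplies words for inverses. Both free groups and free products are instances.\<close>

lemma hom_from_relations:
  fixes v :: "'l \<Rightarrow> 'g" and f :: "'l \<Rightarrow> 'h"
  assumes "group G" "group K"
    and v: "v ` L \<subseteq> carrier G" and f: "f ` L \<subseteq> carrier K"
    and surj: "\<And>x. x \<in> carrier G \<Longrightarrow> \<exists>w. set w \<subseteq> L \<and> list_prod G (map v w) = x"
    and rel: "\<And>w. set w \<subseteq> L \<Longrightarrow> list_prod G (map v w) = \<one>\<^bsub>G\<^esub> \<Longrightarrow> list_prod K (map f w) = \<one>\<^bsub>K\<^esub>"
  obtains h where "h \<in> hom G K" "\<And>l. l \<in> L \<Longrightarrow> h (v l) = f l"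
proof -
  interpret G: group G by fact
  interpret K: group K by fact
  let ?v = "\<lambda>w. list_prod G (map v w)" and ?f = "\<lambda>w. list_prod K (map f w)"
  have [simp]: "?v w \<in> carrier G" "?f w \<in> carrier K" if "set w \<subseteq> L" for w
    proof -
    have "set (map v w) \<subseteq> carrier G" "set (map f w) \<subseteq> carrier K" using that v f by auto
    then show "?v w \<in> carrier G" "?f w \<in> carrier K" by simp_all
  qed
  have app: "?v (w @ w') = ?v w \<otimes>\<^bsub>G\<^esub> ?v w'" "?f (w @ w') = ?f w \<otimes>\<^bsub>K\<^esub> ?f w'"
    if "set w \<subseteq> L" "set w' \<subseteq> L" for w w'
  proof -
    show "?v (w @ w') = ?v w \<otimes>\<^bsub>G\<^esub> ?v w'" unfolding map_append
      using that v by (intro G.list_prod_append) auto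
    show "?f (w @ w') = ?f w \<otimes>\<^bsub>K\<^esub> ?f w'" unfolding map_append
      using that f by (intro K.list_prod_append) auto
  qed
  have wd: "?f w = ?f w'" if w: "set w \<subseteq> L" "set w' \<subseteq> L" "?v w = ?v w'" for w w'
  proof -
    \<comment> \<open>Appending one word for the inverse makes relators of both \<open>w\<close> and
      \<open>w'\<close>; in \<open>K\<close> the common tail then cancels.\<close>
    obtain u where u: "set u \<subseteq> L" "?v u = inv\<^bsub>G\<^esub> (?v w)" using surj[of "inv\<^bsub>G\<^esub> (?v w)"] w by auto
    have "?v (w @ u) = \<one>\<^bsub>G\<^esub>" "?v (w' @ u) = \<one>\<^bsub>G\<^esub>" using w u app by (auto simp del: map_append)
    then have "?f (w @ u) = \<one>\<^bsub>K\<^esub>" "?f (w' @ u) = \<one>\<^bsub>K\<^esub>" using rel w u by (auto simp del: map_append)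
    then have "?f w \<otimes>\<^bsub>K\<^esub> ?f u = ?f w' \<otimes>\<^bsub>K\<^esub> ?f u" using app w u by metis
    then show ?thesis using w u by simp
  qed
  define h where "h x = ?f (SOME w. set w \<subseteq> L \<and> ?v w = x)" for x
  have h: "h (?v w) = ?f w" if "set w \<subseteq> L" for w
  proof -
    have "set (SOME w'. set w' \<subseteq> L \<and> ?v w' = ?v w) \<subseteq> L \<and> ?v (SOME w'. set w' \<subseteq> L \<and> ?v w' = ?v w) = ?v w"
      using that by (intro someI[of "\<lambda>w'. set w' \<subseteq> L \<and> ?v w' = ?v w"]) auto
    then show ?thesis unfolding h_def using wd that by blast
  qed
  show thesis
  proof
    show "h \<in> hom G K"
    proof (rule homI)
      fix x y assume "x \<in> carrier G" "y \<in> carrier G"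
      then obtain w w' where w: "set w \<subseteq> L" "?v w = x" "set w' \<subseteq> L" "?v w' = y" using surj by meson
      have "set (w @ w') \<subseteq> L" using w by simp
      from h[OF this] show "h (x \<otimes>\<^bsub>G\<^esub> y) = h x \<otimes>\<^bsub>K\<^esub> h y"
        using h[of w] h[of w'] app[of w w'] w by metis
    next
      fix x assume "x \<in> carrier G"
      then obtain w where "set w \<subseteq> L" "?v w = x" using surj by meson
      then show "h x \<in> carrier K" using h[of w] by auto
    qed
    show "h (v l) = f l" if "l \<in> L" for l
      using h[of "[l]"] that v f by (auto simp: image_subset_iff)
  qed
qed

text \<open>The universal property of a free group, recovered from reduced words: a word of value
  one reduces to the empty word, and reduction changes the value neither in \<open>G\<close> nor,
  after substitution by \<open>\<phi>\<close>, in \<open>K\<close>.\<close>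

lemma free_basis_hom:
  assumes "group G" "group K" and S: "free_basis G S" and \<phi>: "\<phi> ` S \<subseteq> carrier K"
  obtains h where "h \<in> hom G K" "\<And>s. s \<in> S \<Longrightarrow> h s = \<phi> s"
proof -
  interpret G: group G by fact
  interpret K: group K by fact
  have SG: "S \<subseteq> carrier G" using S by (simp add: free_basis_def)
  have [simp]: "apfst (\<lambda>x :: 'a. x) = (\<lambda>l :: 'a \<times> bool. l)" by (auto simp: fun_eq_iff)
  have wv: "list_prod K (map (letter_val K \<circ> apfst \<phi>) w) = word_val K (map (apfst \<phi>) w)" for w
    by (simp add: word_val_def)
  obtain h where h: "h \<in> hom G K" "\<And>l. l \<in> S \<times> UNIV \<Longrightarrow> h (letter_val G l) = (letter_val K \<circ> apfst \<phi>) l"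
  proof (rule hom_from_relations[of G K "letter_val G" "S \<times> UNIV" "letter_val K \<circ> apfst \<phi>"])
    show "letter_val G ` (S \<times> UNIV) \<subseteq> carrier G" using SG by auto
    show "(letter_val K \<circ> apfst \<phi>) ` (S \<times> UNIV) \<subseteq> carrier K" using \<phi> by auto
  next
    fix x assume "x \<in> carrier G"
    then have "x \<in> generate G S" using S by (simp add: free_basis_def)
    from G.generate_reduced_word[OF SG this] obtain w where "fst ` set w \<subseteq> S" "word_val G w = x"
      by metis
    then show "\<exists>w. set w \<subseteq> S \<times> UNIV \<and> list_prod G (map (letter_val G) w) = x"
      by (intro exI[of _ w]) (auto simp: word_val_def)
  next
    fix w assume w: "set w \<subseteq> S \<times> (UNIV :: bool set)" "list_prod G (map (letter_val G) w) = \<one>\<^bsub>G\<^esub>"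
    then have w': "fst ` set w \<subseteq> S" by auto
    have "word_val G (reduce_word w) = \<one>\<^bsub>G\<^esub>"
      using G.word_val_reduce_word[of "\<lambda>x. x" w] w w' SG by (auto simp: word_val_def)
    moreover have "fst ` set (reduce_word w) \<subseteq> S" using set_reduce_word[of w] w' by blast
    ultimately have "reduce_word w = []" using S reduced_word_reduce_word unfolding free_basis_def by metis
    moreover have "\<phi> ` fst ` set w \<subseteq> carrier K" using w' \<phi> by blast
    ultimately show "list_prod K (map (letter_val K \<circ> apfst \<phi>) w) = \<one>\<^bsub>K\<^esub>"
      using K.word_val_reduce_word[of \<phi> w] unfolding wv by simp
  qed (use assms in auto)
  have "h s = \<phi> s" if "s \<in> S" for s using h(2)[of "(s, True)"] that by (simp add: letter_val_def)
  with h(1) show thesis using that by blast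
qed

section \<open>The universal property of free products\<close>

lemma not_successively_split:
  "\<not> successively P xs \<Longrightarrow> \<exists>us x y vs. xs = us @ x # y # vs \<and> \<not> P x y"
proof (induction P xs rule: successively.induct)
  case (3 P x y xs)
  show ?case
  proof (cases "P x y")
    case True
    with 3 obtain us x' y' vs where "y # xs = us @ x' # y' # vs" "\<not> P x' y'" by auto
    then show ?thesis by (intro exI[of _ "x # us"]) auto
  next
    case False
    then show ?thesis by (intro exI[of _ "[]"]) auto
  qed
qed auto

lemma internal_free_product_disjoint:
  assumes "group G" "internal_free_product G U1 U2"
  shows "U1 \<inter> U2 = {\<one>\<^bsub>G\<^esub>}"
proof -
  interpret G: group G by fact
  have sub: "subgroup U1 G" "subgroup U2 G" using assms(2) by (auto simp: internal_free_product_def)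
  have "x = \<one>\<^bsub>G\<^esub>" if x: "x \<in> U1" "x \<in> U2" for x
  proof (rule ccontr)
    assume "x \<noteq> \<one>\<^bsub>G\<^esub>"
    moreover have xc: "x \<in> carrier G" using x sub subgroup.mem_carrier by metis
    moreover have "inv\<^bsub>G\<^esub> x \<in> U2" using sub x subgroup.m_inv_closed by metis
    ultimately have "list_prod G [x, inv\<^bsub>G\<^esub> x] \<noteq> \<one>\<^bsub>G\<^esub>"
      using assms(2) x unfolding internal_free_product_def
      by (elim conjE allE[of _ "[x, inv\<^bsub>G\<^esub> x]"]) (auto simp: G.inv_eq_1_iff)
    then show False using xc by simp
  qed
  then show ?thesis using sub subgroup.one_closed by blast
qed

text \<open>By the normal form, a nonempty list of factor elements with product one contains the
  identity or two neighbours from one factor. Deleting or merging them shortens the list and changes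
  neither product, so induction on the length shows that the image has product one.\<close>

lemma free_product_hom:
  assumes "group G" "group K" and ifp: "internal_free_product G U1 U2"
    and f1: "f1 \<in> hom (G\<lparr>carrier := U1\<rparr>) K" and f2: "f2 \<in> hom (G\<lparr>carrier := U2\<rparr>) K"
  obtains h where "h \<in> hom G K" "\<And>x. x \<in> U1 \<Longrightarrow> h x = f1 x" "\<And>x. x \<in> U2 \<Longrightarrow> h x = f2 x"
proof -
  interpret G: group G by fact
  interpret K: group K by fact
  have sub: "subgroup U1 G" "subgroup U2 G" and gen: "generate G (U1 \<union> U2) = carrier G"
    using ifp by (auto simp: internal_free_product_def)
  interpret U1: subgroup U1 G by fact
  interpret U2: subgroup U2 G by fact
  have G1: "group (G\<lparr>carrier := U1\<rparr>)" and G2: "group (G\<lparr>carrier := U2\<rparr>)"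
    using sub G.subgroup_imp_group by auto
  have one: "f1 \<one>\<^bsub>G\<^esub> = \<one>\<^bsub>K\<^esub>" "f2 \<one>\<^bsub>G\<^esub> = \<one>\<^bsub>K\<^esub>"
    using hom_one[OF f1 G1 assms(2)] hom_one[OF f2 G2 assms(2)] by simp_all
  have UG: "U1 \<union> U2 \<subseteq> carrier G" using U1.subset U2.subset by blast
  \<comment> \<open>On the overlap of the factors the first map wins; the overlap is trivial, so
    \<open>f\<close> extends \<open>f2\<close> as well.\<close>
  define f where "f x = (if x \<in> U1 then f1 x else f2 x)" for x
  have f_1: "f x = f1 x" if "x \<in> U1" for x using that by (simp add: f_def)
  have f_2: "f x = f2 x" if "x \<in> U2" for x
    using that internal_free_product_disjoint[OF assms(1) ifp] one unfolding f_def
    by (metis IntI singletonD)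
  have f_closed: "f x \<in> carrier K" if "x \<in> U1 \<union> U2" for x
    using that f1 f2 f_1 f_2 by (auto simp: hom_def)
  have rel: "list_prod K (map f w) = \<one>\<^bsub>K\<^esub>" if "set w \<subseteq> U1 \<union> U2" "list_prod G w = \<one>\<^bsub>G\<^esub>" for w
    using that
  proof (induction w rule: length_induct)
    case (1 w)
    note IH = 1(1)[rule_format] and w = 1(2,3)
    consider "w = []" | "\<one>\<^bsub>G\<^esub> \<in> set w"
      | "\<not> successively (\<lambda>x y. (x \<in> U1 \<and> y \<in> U2) \<or> (x \<in> U2 \<and> y \<in> U1)) w"
    proof -
      have "set w \<subseteq> U1 \<union> U2 - {\<one>\<^bsub>G\<^esub>}" if "\<one>\<^bsub>G\<^esub> \<notin> set w" using w that by blast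
      then show thesis using ifp w(2) that unfolding internal_free_product_def by blast
    qed
    then show ?case
    proof cases
      case 2
      then obtain us vs where us: "w = us @ \<one>\<^bsub>G\<^esub> # vs" by (meson split_list)
      have "set us \<subseteq> U1 \<union> U2" "set vs \<subseteq> U1 \<union> U2" using us w by auto
      then have "list_prod K (map f (us @ vs)) = \<one>\<^bsub>K\<^esub>"
        using IH[of "us @ vs"] us w UG G.list_prod_remove_one[of us vs] by simp
      moreover have "list_prod K (map f us @ \<one>\<^bsub>K\<^esub> # map f vs) = list_prod K (map f us @ map f vs)"
        using w us f_closed by (intro K.list_prod_remove_one) auto
      ultimately show ?thesis using us one by (simp add: f_1)
    next
      case 3
      then obtain us x y vs where us: "w = us @ x # y # vs"
        and xy: "\<not> ((x \<in> U1 \<and> y \<in> U2) \<or> (x \<in> U2 \<and> y \<in> U1))"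
        using not_successively_split by (metis (no_types, lifting))
      \<comment> \<open>Neighbours that are not in opposite factors lie in a common one, where
        \<open>f\<close> is multiplicative.\<close>
      have "x \<in> U1 \<and> y \<in> U1 \<or> x \<in> U2 \<and> y \<in> U2" using xy us w by auto
      then have m: "x \<otimes>\<^bsub>G\<^esub> y \<in> U1 \<union> U2" "f (x \<otimes>\<^bsub>G\<^esub> y) = f x \<otimes>\<^bsub>K\<^esub> f y"
        using f1 f2 by (auto simp: f_1 f_2 hom_def)
      have "list_prod G (us @ (x \<otimes>\<^bsub>G\<^esub> y) # vs) = \<one>\<^bsub>G\<^esub>"
        using w us UG by (subst G.list_prod_merge[symmetric]) auto
      then have "list_prod K (map f (us @ (x \<otimes>\<^bsub>G\<^esub> y) # vs)) = \<one>\<^bsub>K\<^esub>"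
        using IH[of "us @ (x \<otimes>\<^bsub>G\<^esub> y) # vs"] us w m by auto
      moreover have "list_prod K (map f us @ f x # f y # map f vs) = list_prod K (map f us @ (f x \<otimes>\<^bsub>K\<^esub> f y) # map f vs)"
        using w us f_closed by (intro K.list_prod_merge) auto
      ultimately show ?thesis using us m by simp
    qed simp
  qed
  obtain h where h: "h \<in> hom G K" "\<And>x. x \<in> U1 \<union> U2 \<Longrightarrow> h x = f x"
  proof (rule hom_from_relations[of G K "\<lambda>x. x" "U1 \<union> U2" f])
    show "(\<lambda>x. x) ` (U1 \<union> U2) \<subseteq> carrier G" using UG by simp
    show "f ` (U1 \<union> U2) \<subseteq> carrier K" using f_closed by blast
    show "\<exists>w. set w \<subseteq> U1 \<union> U2 \<and> list_prod G (map (\<lambda>x. x) w) = x" if "x \<in> carrier G" for x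
      using G.generate_eq_list_prod[OF UG, of x] that gen by auto
  qed (use assms rel in auto)
  show thesis
  proof (rule that[OF h(1)])
    show "h x = f1 x" if "x \<in> U1" for x using h(2)[of x] f_1 that by simp
    show "h x = f2 x" if "x \<in> U2" for x using h(2)[of x] f_2 that by simp
  qed
qed

lemma hom_eq_on_generators:
  assumes "group G" "group K" "h \<in> hom G K" "k \<in> hom G K"
    and gen: "generate G S = carrier G" and S: "S \<subseteq> carrier G"
    and eq: "\<And>s. s \<in> S \<Longrightarrow> h s = k s" and x: "x \<in> carrier G"
  shows "h x = k x"
proof -
  interpret h: group_hom G K h using assms by (simp add: group_hom_def group_hom_axioms_def)
  interpret k: group_hom G K k using assms by (simp add: group_hom_def group_hom_axioms_def)
  have "x \<in> generate G S" using x gen by simp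
  then show ?thesis
  proof (induction rule: generate.induct)
    case (eng x y)
    then show ?case using gen by simp
  qed (use eq S in auto)
qed

section \<open>Uniqueness of roots\<close>

text \<open>Equal first letters cancel and the tails are compared. If the first letters differ, the
  inverse of one word followed by the other is reduced, nonempty and of value one, which freeness
  forbids.\<close>

lemma (in group) reduced_word_unique:
  assumes S: "free_basis G S"
  shows "fst ` set u \<subseteq> S \<Longrightarrow> fst ` set v \<subseteq> S \<Longrightarrow> reduced_word u \<Longrightarrow> reduced_word v \<Longrightarrow>
    word_val G u = word_val G v \<Longrightarrow> u = v"
proof (induction u arbitrary: v)
  case Nil
  then show ?case using S unfolding free_basis_def by (metis word_val_Nil)
next
  case (Cons l u)
  have SG: "S \<subseteq> carrier G" using S by (simp add: free_basis_def)
  show ?case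
  proof (cases v)
    case Nil
    then show ?thesis using Cons.prems S unfolding free_basis_def by (metis word_val_Nil list.distinct(1))
  next
    case v: (Cons l' v')
    have c: "letter_val G l \<in> carrier G" "word_val G u \<in> carrier G" "word_val G v' \<in> carrier G"
      using Cons.prems v SG by (auto intro!: letter_val_closed word_val_closed)
    show ?thesis
    proof (cases "l = l'")
      case True
      have "word_val G u = word_val G v'" using Cons.prems v True c by simp
      moreover have "reduced_word u" "reduced_word v'"
        using Cons.prems(3,4) v by (auto simp: reduced_word_Cons)
      moreover have "fst ` set u \<subseteq> S" "fst ` set v' \<subseteq> S" using Cons.prems(1,2) v by auto
      ultimately show ?thesis using Cons.IH v True by blast
    next
      case False
      have "reduced_word (inv_word (l # u) @ v)"
        unfolding reduced_word_append_iff reduced_word_inv_word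
        using Cons.prems v False by (auto simp: prod_eq_iff)
      moreover have u: "fst ` set (inv_word (l # u)) \<subseteq> S"
        using Cons.prems(1) by (simp only: inv_word_simps(5))
      moreover have "fst ` set (inv_word (l # u) @ v) \<subseteq> S" using u Cons.prems(2)
        by (simp only: set_append image_Un Un_least)
      moreover have "inv_word (l # u) @ v \<noteq> []" using v by simp
      ultimately have "word_val G (inv_word (l # u) @ v) \<noteq> \<one>"
        using S unfolding free_basis_def by blast
      moreover have sub: "fst ` set (l # u) \<subseteq> carrier G" "fst ` set (inv_word (l # u)) \<subseteq> carrier G"
          "fst ` set v \<subseteq> carrier G"
        using Cons.prems(1,2) u SG by (meson subset_trans)+
      have "word_val G (inv_word (l # u) @ v) = \<one>"
        unfolding word_val_append[OF sub(2,3)] word_val_inv_word[OF sub(1)] Cons.prems(5)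
        using sub(3) by simp
      ultimately show ?thesis by contradiction
    qed
  qed
qed

text \<open>Inverse letters at the two ends are stripped until none remain. Reducedness of
  \<open>r @ r\<close> says that \<open>r\<close> is cyclically reduced; the last conjunct rules out
  an empty core with a nonempty conjugator.\<close>

lemma reduced_word_conj_core:
  assumes "reduced_word w"
  shows "\<exists>u r. w = u @ r @ inv_word u \<and> reduced_word (r @ r) \<and> (r = [] \<longrightarrow> u = [])"
  using assms
proof (induction w rule: length_induct)
  case (1 w)
  note IH = 1(1)[rule_format]
  show ?case
  proof (cases "reduced_word (w @ w)")
    case True
    then show ?thesis by (intro exI[of _ "[]"] exI[of _ w]) simp
  next
    case False
    then have ne: "w \<noteq> []" and x: "fst (last w) = fst (hd w)" "snd (last w) \<noteq> snd (hd w)"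
      using 1(2) by (auto simp: reduced_word_append_iff)
    then obtain l w1 where w1: "w = l # w1" by (cases w) auto
    \<comment> \<open>A single letter is not its own inverse, and two inverse letters alone are not
      reduced, so a nonempty middle part remains.\<close>
    with x have "w1 \<noteq> []" by auto
    then obtain w2 l' where w2: "w = l # w2 @ [l']" using w1 by (metis append_butlast_last_id)
    have l': "l' = apsnd Not l" using x w2 by (cases l; cases l') auto
    have r2: "reduced_word w2" "w2 \<noteq> []"
      using 1(2) w2 x by (auto simp: reduced_word_Cons reduced_word_append_iff)
    obtain u r where ur: "w2 = u @ r @ inv_word u" "reduced_word (r @ r)" "r = [] \<longrightarrow> u = []"
      using IH[of w2] r2 w2 by auto
    show ?thesis using ur w2 l' r2 by (intro exI[of _ "l # u"] exI[of _ r]) auto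
  qed
qed

lemma reduced_word_power:
  assumes "reduced_word (r @ r)"
  shows "reduced_word (concat (replicate (Suc k) r))"
proof (induction k)
  case 0
  then show ?case using assms by (simp add: reduced_word_append_iff)
next
  case (Suc k)
  have "concat (replicate (Suc (Suc k)) r) = r @ r @ concat (replicate k r)" by simp
  moreover have "concat (replicate (Suc k) r) = r @ concat (replicate k r)" by simp
  ultimately show ?case using Suc assms
    by (cases "r = []") (simp_all add: reduced_word_append_iff)
qed

text \<open>The power has the first and last letters of \<open>r\<close>, so its junctions with
  \<open>u\<close> and \<open>inv_word u\<close> are those of the original word.\<close>

lemma reduced_word_conj_power:
  assumes "reduced_word (u @ r @ inv_word u)" "reduced_word (r @ r)" "r = [] \<longrightarrow> u = []"
  shows "reduced_word (u @ concat (replicate (Suc k) r) @ inv_word u)"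
proof (cases "r = []")
  case False
  have "hd (concat (replicate (Suc k) r)) = hd r" using False by simp
  moreover have "last (concat (replicate (Suc k) r)) = last r"
    using False by (induction k) auto
  moreover have "concat (replicate (Suc k) r) \<noteq> []" using False by simp
  ultimately show ?thesis using False assms reduced_word_power[OF assms(2), of k]
    by (auto simp: reduced_word_append_iff simp del: concat.simps replicate.simps)
qed (use assms in simp)

text \<open>Conjugates of cyclically reduced words have powers whose reduced words have known
  length. The exponents n and 2n give two length equations, so conjugators and cores have equal
  lengths; cutting the equal words at these lengths identifies them.\<close>

theorem (in group) free_basis_root_unique:
  assumes S: "free_basis G S" and xy: "x \<in> carrier G" "y \<in> carrier G"
    and n: "n > 0" and eq: "x [^] (n::nat) = y [^] n"
  shows "x = y"
proof -
  have SG: "S \<subseteq> carrier G" and gen: "generate G S = carrier G" using S by (auto simp: free_basis_def)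
  have core: "\<exists>u r. fst ` set u \<subseteq> S \<and> fst ` set r \<subseteq> S \<and> (\<forall>k. word_val G (u @ concat (replicate k r) @ inv_word u) = z [^] k)
      \<and> (\<forall>k. reduced_word (u @ concat (replicate (Suc k) r) @ inv_word u))" if z: "z \<in> carrier G" for z
  proof -
    obtain w where w: "fst ` set w \<subseteq> S" "reduced_word w" "word_val G w = z"
      using generate_reduced_word[OF SG, of z] z gen by metis
    obtain u r where ur: "w = u @ r @ inv_word u" "reduced_word (r @ r)" "r = [] \<longrightarrow> u = []"
      using reduced_word_conj_core[OF w(2)] by blast
    have sub: "fst ` set u \<subseteq> S" "fst ` set r \<subseteq> S" using w ur by auto
    have subG: "fst ` set u \<subseteq> carrier G" "fst ` set r \<subseteq> carrier G"
       "fst ` set (inv_word u) \<subseteq> carrier G" using sub SG by (simp_all only: inv_word_simps)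
    define p q where "p = word_val G u" and "q = word_val G r"
    have pq: "p \<in> carrier G" "q \<in> carrier G" using subG by (simp_all add: p_def q_def)
    have val: "word_val G (u @ concat (replicate k r) @ inv_word u) = p \<otimes> q [^] k \<otimes> inv p" for k
    proof -
      have "fst ` set (concat (replicate k r)) \<subseteq> carrier G" using subG(2) by fastforce
      then show ?thesis
        using subG pq by (simp add: word_val_append word_val_inv_word word_val_replicate_concat m_assoc
            p_def q_def image_Un del: inv_word_simps(5))
    qed
    have z: "z = p \<otimes> q \<otimes> inv p" using val[of 1] w ur pq by simp
    have "z [^] k = p \<otimes> q [^] k \<otimes> inv p" for k :: nat
    proof (induction k)
      case (Suc k)
      have "inv p \<otimes> (p \<otimes> (q \<otimes> inv p)) = q \<otimes> inv p" using pq by (simp add: m_assoc[symmetric])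
      then show ?case using Suc pq unfolding z by (simp add: m_assoc)
    qed (use pq in simp)
    then have "word_val G (u @ concat (replicate k r) @ inv_word u) = z [^] k" for k
      using val by simp
    moreover have "reduced_word (u @ concat (replicate (Suc k) r) @ inv_word u)" for k
      using reduced_word_conj_power[of u r k] ur w by simp
    ultimately show ?thesis using sub by blast
  qed
  obtain u r where x: "fst ` set u \<subseteq> S" "fst ` set r \<subseteq> S"
      "\<And>k. word_val G (u @ concat (replicate k r) @ inv_word u) = x [^] k"
      "\<And>k. reduced_word (u @ concat (replicate (Suc k) r) @ inv_word u)"
    using core[OF xy(1)] by blast
  obtain v s where y: "fst ` set v \<subseteq> S" "fst ` set s \<subseteq> S"
      "\<And>k. word_val G (v @ concat (replicate k s) @ inv_word v) = y [^] k"
      "\<And>k. reduced_word (v @ concat (replicate (Suc k) s) @ inv_word v)"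
    using core[OF xy(2)] by blast
  have words: "u @ concat (replicate k r) @ inv_word u = v @ concat (replicate k s) @ inv_word v"
    if k: "x [^] k = y [^] k" "k > 0" for k
  proof (rule reduced_word_unique[OF S])
    have "fst ` set (concat (replicate k r)) \<subseteq> S" "fst ` set (concat (replicate k s)) \<subseteq> S"
      using x(2) y(2) by fastforce+
    then show "fst ` set (u @ concat (replicate k r) @ inv_word u) \<subseteq> S"
      "fst ` set (v @ concat (replicate k s) @ inv_word v) \<subseteq> S"
      unfolding set_append image_Un inv_word_simps using x(1) y(1) by (simp_all only: Un_least)
    show "reduced_word (u @ concat (replicate k r) @ inv_word u)"
      "reduced_word (v @ concat (replicate k s) @ inv_word v)"
      using x(4)[of "k - 1"] y(4)[of "k - 1"] k(2) by simp_all
  qed (use x y k in simp)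
  have len: "length (concat (replicate k w)) = k * length w" for k and w :: "('a \<times> bool) list"
    by (induction k) auto
  \<comment> \<open>The length at exponent \<open>n\<close> alone does not separate
    \<open>length u\<close> from \<open>length r\<close>; doubling the exponent supplies a second
    equation.\<close>
  have "x [^] (n + n) = y [^] (n + n)" using eq xy by (simp add: nat_pow_mult[symmetric])
  from words[OF this] words[OF eq] n
  have w1: "u @ concat (replicate n r) @ inv_word u = v @ concat (replicate n s) @ inv_word v"
    and w2: "u @ concat (replicate (n + n) r) @ inv_word u = v @ concat (replicate (n + n) s) @ inv_word v"
    by auto
  have "length u + n * length r + length u = length v + n * length s + length v"
    using arg_cong[OF w1, of length] by (simp only: length_append len inv_word_simps(4) add.assoc)
  moreover have "length u + (n + n) * length r + length u = length v + (n + n) * length s + length v"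
    using arg_cong[OF w2, of length] by (simp only: length_append len inv_word_simps(4) add.assoc)
  ultimately have "n * length r = n * length s" and luv: "length u = length v"
    unfolding add_mult_distrib by linarith+
  then have lrs: "length r = length s" using n by simp
  have "concat (replicate n r) = concat (replicate n s)" "u = v"
    using w1 luv lrs len by auto
  moreover obtain n' where "n = Suc n'" using n by (cases n) auto
  ultimately have "r = s" using lrs by simp
  then have "u @ concat (replicate 1 r) @ inv_word u = v @ concat (replicate 1 s) @ inv_word v"
    using \<open>u = v\<close> by simp
  then have "x [^] (1::nat) = y [^] (1::nat)" unfolding x(3)[of 1, symmetric] y(3)[of 1, symmetric] by simp
  then show ?thesis using xy by simp
qed

text \<open>The signs make every a^n b^n vanish, and modulo two the value is the parity of the word
  length. The character describes the retraction, tells basis elements apart and detects the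
  index.\<close>

lemma exponent_difference_hom:
  assumes "group F" "a \<noteq> b" "free_basis F {a, b}"
  obtains \<eta> where "\<eta> \<in> hom F integer_group" "\<eta> a = 1" "\<eta> b = -1"
proof (rule free_basis_hom[OF assms(1) group_integer_group assms(3), of "\<lambda>x. if x = a then 1 else -1"])
  fix h assume "h \<in> hom F integer_group" "\<And>s. s \<in> {a, b} \<Longrightarrow> h s = (if s = a then 1 else - 1)"
  then show thesis using that[of h] assms(2) by auto
qed simp

section \<open>The element is not simple in the whole group\<close>

definition int_wreath :: "('a, 'm) monoid_scheme \<Rightarrow> ((int \<Rightarrow> 'a) \<times> int) monoid" where
  "int_wreath A = \<lparr>carrier = (UNIV \<rightarrow> carrier A) \<times> UNIV,
     monoid.mult = (\<lambda>x y. (\<lambda>k. fst x k \<otimes>\<^bsub>A\<^esub> fst y (k + snd x), snd x + snd y)),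
     one = (\<lambda>_. \<one>\<^bsub>A\<^esub>, 0)\<rparr>"

lemma int_wreath_simps [simp]:
  "x \<in> carrier (int_wreath A) \<longleftrightarrow> (\<forall>k. fst x k \<in> carrier A)"
  "x \<otimes>\<^bsub>int_wreath A\<^esub> y = (\<lambda>k. fst x k \<otimes>\<^bsub>A\<^esub> fst y (k + snd x), snd x + snd y)"
  "\<one>\<^bsub>int_wreath A\<^esub> = (\<lambda>_. \<one>\<^bsub>A\<^esub>, 0)"
  by (cases x) (auto simp: int_wreath_def)

lemma group_int_wreath:
  assumes "group A"
  shows "group (int_wreath A)"
proof -
  interpret A: group A by fact
  show ?thesis
  proof (rule groupI)
    fix x assume x: "x \<in> carrier (int_wreath A)"
    show "\<exists>y\<in>carrier (int_wreath A). y \<otimes>\<^bsub>int_wreath A\<^esub> x = \<one>\<^bsub>int_wreath A\<^esub>"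
      by (rule bexI[of _ "(\<lambda>k. inv\<^bsub>A\<^esub> (fst x (k - snd x)), - snd x)"]) (use x in auto)
  qed (auto simp: A.m_assoc algebra_simps)
qed

lemma (in group) commute_inv:
  assumes "x \<in> carrier G" "y \<in> carrier G" and eq: "x \<otimes> y = y \<otimes> x"
  shows "x \<otimes> inv y = inv y \<otimes> x"
proof -
  have "x \<otimes> inv y = inv y \<otimes> (y \<otimes> x) \<otimes> inv y" using assms(1,2) by (simp add: m_assoc[symmetric])
  also have "\<dots> = inv y \<otimes> x" using assms(1,2) by (simp add: eq[symmetric] m_assoc)
  finally show ?thesis .
qed

theorem not_simple_in_free_basis:
  fixes n :: nat
  assumes "group F" "a \<noteq> b" and basis: "free_basis F {a, b}" and n: "n \<ge> 2"
  shows "\<not> simple_in F (a [^]\<^bsub>F\<^esub> n \<otimes>\<^bsub>F\<^esub> b [^]\<^bsub>F\<^esub> n)" (is "\<not> simple_in F ?g")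
proof
  assume "simple_in F ?g"
  then obtain U1 U2 where ifp: "internal_free_product F U1 U2"
    and U2: "U2 \<noteq> {\<one>\<^bsub>F\<^esub>}" and g: "?g \<in> U1"
    by (auto simp: simple_in_def)
  interpret F: group F by fact
  have ab: "a \<in> carrier F" "b \<in> carrier F" and gen: "generate F {a, b} = carrier F"
    using basis by (auto simp: free_basis_def)
  have sub: "subgroup U1 F" "subgroup U2 F" and gen': "generate F (U1 \<union> U2) = carrier F"
    using ifp by (auto simp: internal_free_product_def)
  interpret U1: subgroup U1 F by fact
  interpret U2: subgroup U2 F by fact
  have UF: "U1 \<union> U2 \<subseteq> carrier F" using U1.subset U2.subset by blast
  have abF: "{a, b} \<subseteq> carrier F" using ab by simp

  obtain \<rho> where \<rho>: "\<rho> \<in> hom F (F\<lparr>carrier := U2\<rparr>)"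
    and \<rho>1: "\<And>x. x \<in> U1 \<Longrightarrow> \<rho> x = \<one>\<^bsub>F\<^esub>" and \<rho>2: "\<And>x. x \<in> U2 \<Longrightarrow> \<rho> x = x"
  proof (rule free_product_hom[OF F.group_axioms F.subgroup_imp_group[OF sub(2)] ifp,
        of "\<lambda>_. \<one>\<^bsub>F\<^esub>" "\<lambda>x. x"])
    show "(\<lambda>_. \<one>\<^bsub>F\<^esub>) \<in> hom (F\<lparr>carrier := U1\<rparr>) (F\<lparr>carrier := U2\<rparr>)" by (auto intro: homI)
    show "(\<lambda>x. x) \<in> hom (F\<lparr>carrier := U2\<rparr>) (F\<lparr>carrier := U2\<rparr>)" by (auto intro: homI)
  qed (rule that; assumption)
  have \<rho>_U2: "\<rho> x \<in> U2" if "x \<in> carrier F" for x using \<rho> that by (auto simp: hom_def)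
  then have \<rho>_F: "\<rho> \<in> hom F F" using \<rho> U2.subset by (auto simp: hom_def)
  interpret \<rho>: group_hom F F \<rho> using \<rho>_F by unfold_locales
  define t where "t = \<rho> a"
  have t: "t \<in> U2" "t \<in> carrier F" using \<rho>_U2[of a] ab by (auto simp: t_def)
  \<comment> \<open>\<open>\<rho>\<close> kills a^n b^n, so the n-th powers of \<open>t\<close> and
    of the inverse of \<open>\<rho> b\<close> agree; uniqueness of roots removes the
    exponent.\<close>
  have "t [^]\<^bsub>F\<^esub> n \<otimes>\<^bsub>F\<^esub> \<rho> b [^]\<^bsub>F\<^esub> n = \<one>\<^bsub>F\<^esub>"
    using \<rho>1[OF g] ab by (simp add: \<rho>.hom_nat_pow t_def)
  then have "inv\<^bsub>F\<^esub> (\<rho> b [^]\<^bsub>F\<^esub> n) = t [^]\<^bsub>F\<^esub> n"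
    using t ab by (intro F.inv_equality) auto
  then have "t [^]\<^bsub>F\<^esub> n = (inv\<^bsub>F\<^esub> (\<rho> b)) [^]\<^bsub>F\<^esub> n"
    using ab by (simp add: F.nat_pow_inv)
  then have "t = inv\<^bsub>F\<^esub> (\<rho> b)"
    using n ab by (intro F.free_basis_root_unique[OF basis t(2), of _ n]) auto
  then have \<rho>b: "\<rho> b = inv\<^bsub>F\<^esub> t" using ab by simp

  obtain \<eta> where \<eta>: "\<eta> \<in> hom F integer_group" "\<eta> a = 1" "\<eta> b = -1"
    by (rule exponent_difference_hom[OF assms(1-3)])
  interpret \<eta>: group_hom F integer_group \<eta> using \<eta>(1)
    by (intro group_hom.intro group_hom_axioms.intro) simp_all
  \<comment> \<open>\<open>\<rho>\<close> sends the basis to \<open>t\<close> and its inverse, hence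
    coincides with \<open>\<eta>\<close> followed by powers of \<open>t\<close>.\<close>
  have \<rho>_pow: "\<rho> x = t [^]\<^bsub>F\<^esub> \<eta> x" if x: "x \<in> carrier F" for x
  proof (rule hom_eq_on_generators[OF F.group_axioms F.group_axioms \<rho>_F _ gen abF _ x])
    show "(\<lambda>x. t [^]\<^bsub>F\<^esub> \<eta> x) \<in> hom F F" using t by (auto intro!: homI simp: F.int_pow_mult)
    show "\<rho> s = t [^]\<^bsub>F\<^esub> \<eta> s" if "s \<in> {a, b}" for s
      using that \<eta> \<rho>b t by (auto simp: F.int_pow_neg) (simp add: t_def)
  qed
  \<comment> \<open>\<open>\<rho>\<close> fixes \<open>t\<close>; exponent zero would make
    \<open>t\<close> the identity, and with it the whole image \<open>U2\<close> trivial.\<close>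
  have \<eta>t: "\<eta> t \<noteq> 0"
  proof
    assume "\<eta> t = 0"
    then have "t = \<one>\<^bsub>F\<^esub>" using \<rho>_pow[OF t(2)] \<rho>2[OF t(1)] by simp
    then have "x = \<one>\<^bsub>F\<^esub>" if "x \<in> U2" for x
      using \<rho>_pow[of x] \<rho>2[OF that] that by simp
    then show False using U2 U2.one_closed by blast
  qed

  let ?Z = "integer_mod_group n"
  obtain \<chi> where \<chi>: "\<chi> \<in> hom F ?Z" "\<chi> a = 1" "\<chi> b = 0"
  proof (rule free_basis_hom[OF F.group_axioms group_integer_mod_group basis, of "\<lambda>x. if x = a then 1 else 0" n])
    fix h assume "h \<in> hom F ?Z" "\<And>s. s \<in> {a, b} \<Longrightarrow> h s = (if s = a then 1 else 0)"
    then show thesis using that[of h] \<open>a \<noteq> b\<close> by auto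
  qed (use n in auto)
  interpret \<chi>: group_hom F ?Z \<chi> using \<chi>(1)
    by (intro group_hom.intro group_hom_axioms.intro) simp_all
  have \<chi>g: "\<chi> ?g = 0" using ab n by (simp add: \<chi>.hom_nat_pow \<chi>)

  show False
  proof (cases "\<forall>u\<in>U1. \<chi> u = 0")
    case True
    \<comment> \<open>A character trivial on \<open>U1\<close> factors through
      \<open>\<rho>\<close>. Then \<open>t\<close> and its inverse receive the values 1 and 0 of
      \<open>a\<close> and \<open>b\<close>, whose sum is nonzero modulo \<open>n\<close> because
      \<open>n\<close> is at least 2.\<close>
    have eq: "\<chi> x = \<chi> (\<rho> x)" if x: "x \<in> carrier F" for x
    proof (rule hom_eq_on_generators[OF F.group_axioms group_integer_mod_group \<chi>(1) _ gen' UF _ x])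
      show "(\<lambda>x. \<chi> (\<rho> x)) \<in> hom F ?Z" using hom_compose[OF \<rho>_F \<chi>(1)] by (simp add: o_def)
      show "\<chi> s = \<chi> (\<rho> s)" if "s \<in> U1 \<union> U2" for s
        using that True \<rho>1 \<rho>2 \<chi>.hom_one by auto
    qed
    have "\<chi> t = 1" "\<chi> (inv\<^bsub>F\<^esub> t) = 0" using eq[of a] eq[of b] \<chi> ab \<rho>b by (simp_all add: t_def)
    then have "(1 + 0) mod int n = 0" using \<chi>.hom_mult[of t "inv\<^bsub>F\<^esub> t"] t \<chi>.hom_one by simp
    then show False using n by simp
  next
    case False
    then obtain u where u: "u \<in> U1" "\<chi> u \<noteq> 0" by blast
    let ?W = "int_wreath ?Z"
    have W: "group ?W" by (rule group_int_wreath) simp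
    interpret W: group ?W by fact
    have \<chi>c: "\<chi> x \<in> carrier ?Z" if "x \<in> carrier F" for x using \<chi>.hom_closed that .
    \<comment> \<open>The factors can be mapped independently: \<open>U1\<close> only changes the
      value at position 0, through \<open>\<chi>\<close>, and \<open>U2\<close> only shifts, by
      \<open>\<eta>\<close>.\<close>
    obtain \<psi> where \<psi>: "\<psi> \<in> hom F ?W"
      and \<psi>1: "\<And>x. x \<in> U1 \<Longrightarrow> \<psi> x = (\<lambda>k. if k = 0 then \<chi> x else 0, 0)"
      and \<psi>2: "\<And>x. x \<in> U2 \<Longrightarrow> \<psi> x = (\<lambda>_. 0, \<eta> x)"
    proof (rule free_product_hom[OF F.group_axioms W ifp,
          of "\<lambda>x. (\<lambda>k. if k = 0 then \<chi> x else 0, 0)" "\<lambda>x. (\<lambda>_. 0, \<eta> x)"])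
      show "(\<lambda>x. (\<lambda>k. if k = 0 then \<chi> x else 0, 0)) \<in> hom (F\<lparr>carrier := U1\<rparr>) ?W"
        using \<chi>c by (auto intro!: homI simp: fun_eq_iff)
      show "(\<lambda>x. (\<lambda>_. 0, \<eta> x)) \<in> hom (F\<lparr>carrier := U2\<rparr>) ?W"
        by (auto intro!: homI)
    qed (rule that; assumption)
    interpret \<psi>: group_hom F ?W \<psi> using \<psi> by unfold_locales
    define z where "z = \<psi> (a [^]\<^bsub>F\<^esub> n)"
    have zc: "z \<in> carrier ?W" unfolding z_def using ab by (intro \<psi>.hom_closed) simp
    \<comment> \<open>a^n b^n lies in \<open>U1\<close> and \<open>\<chi>\<close> vanishes on it, so
      \<open>z\<close> is the image both of a^n and of the inverse of b^n. It therefore commutes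
      with the images of \<open>a\<close> and \<open>b\<close>.\<close>
    have "z \<otimes>\<^bsub>?W\<^esub> \<psi> (b [^]\<^bsub>F\<^esub> n) = \<psi> ?g"
      unfolding z_def using ab by (intro \<psi>.hom_mult[symmetric]) auto
    also have "\<dots> = \<one>\<^bsub>?W\<^esub>" using \<psi>1[OF g] \<chi>g by (simp add: fun_eq_iff)
    finally have "z = inv\<^bsub>?W\<^esub> (\<psi> (b [^]\<^bsub>F\<^esub> n))"
      using ab zc by (metis W.inv_equality F.nat_pow_closed \<psi>.hom_closed)
    then have zb: "z = \<psi> (inv\<^bsub>F\<^esub> (b [^]\<^bsub>F\<^esub> n))"
      using ab by (simp only: \<psi>.hom_inv F.nat_pow_closed)
    \<comment> \<open>The elements whose images commute with \<open>z\<close> form a subgroup;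
      containing \<open>a\<close> and \<open>b\<close>, it is all of \<open>F\<close>.\<close>
    let ?C = "{x \<in> carrier F. z \<otimes>\<^bsub>?W\<^esub> \<psi> x = \<psi> x \<otimes>\<^bsub>?W\<^esub> z}"
    have C: "subgroup ?C F"
    proof (rule F.subgroupI)
      show "?C \<noteq> {}" using W.r_one[OF zc] W.l_one[OF zc] \<psi>.hom_one F.one_closed by force
      fix x assume "x \<in> ?C"
      then have x: "x \<in> carrier F" "z \<otimes>\<^bsub>?W\<^esub> \<psi> x = \<psi> x \<otimes>\<^bsub>?W\<^esub> z" by auto
      have "z \<otimes>\<^bsub>?W\<^esub> inv\<^bsub>?W\<^esub> (\<psi> x) = inv\<^bsub>?W\<^esub> (\<psi> x) \<otimes>\<^bsub>?W\<^esub> z"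
        by (rule W.commute_inv) (use x zc in \<open>simp_all del: int_wreath_simps\<close>)
      then show "inv\<^bsub>F\<^esub> x \<in> ?C" using x by (simp del: int_wreath_simps)
      fix y assume "y \<in> ?C"
      then have y: "y \<in> carrier F" "z \<otimes>\<^bsub>?W\<^esub> \<psi> y = \<psi> y \<otimes>\<^bsub>?W\<^esub> z" by auto
      have "z \<otimes>\<^bsub>?W\<^esub> (\<psi> x \<otimes>\<^bsub>?W\<^esub> \<psi> y) = (z \<otimes>\<^bsub>?W\<^esub> \<psi> x) \<otimes>\<^bsub>?W\<^esub> \<psi> y"
        by (rule W.m_assoc[symmetric]) (use x y zc in \<open>simp_all del: int_wreath_simps\<close>)
      also have "\<dots> = \<psi> x \<otimes>\<^bsub>?W\<^esub> (z \<otimes>\<^bsub>?W\<^esub> \<psi> y)"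
        unfolding x(2) by (rule W.m_assoc) (use x y zc in \<open>simp_all del: int_wreath_simps\<close>)
      also have "\<dots> = (\<psi> x \<otimes>\<^bsub>?W\<^esub> \<psi> y) \<otimes>\<^bsub>?W\<^esub> z"
        unfolding y(2) by (rule W.m_assoc[symmetric]) (use x y zc in \<open>simp_all del: int_wreath_simps\<close>)
      finally show "x \<otimes>\<^bsub>F\<^esub> y \<in> ?C" using x y by (simp del: int_wreath_simps)
    qed auto
    have comm: "z \<otimes>\<^bsub>?W\<^esub> \<psi> x = \<psi> x \<otimes>\<^bsub>?W\<^esub> z"
      if "z = \<psi> y" "x \<in> carrier F" "y \<in> carrier F" "y \<otimes>\<^bsub>F\<^esub> x = x \<otimes>\<^bsub>F\<^esub> y" for x y
      using that by (metis \<psi>.hom_mult)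
    have "a [^]\<^bsub>F\<^esub> n \<otimes>\<^bsub>F\<^esub> a = a \<otimes>\<^bsub>F\<^esub> a [^]\<^bsub>F\<^esub> n"
      using F.nat_pow_Suc2[of a n] ab by simp
    then have "a \<in> ?C" using comm[OF z_def] ab by simp
    moreover have "inv\<^bsub>F\<^esub> (b [^]\<^bsub>F\<^esub> n) \<otimes>\<^bsub>F\<^esub> b = b \<otimes>\<^bsub>F\<^esub> inv\<^bsub>F\<^esub> (b [^]\<^bsub>F\<^esub> n)"
      using F.nat_pow_Suc2[of b n] ab by (intro F.commute_inv[symmetric]) auto
    then have "b \<in> ?C" using comm[OF zb] ab by simp
    ultimately have "generate F {a, b} \<subseteq> ?C"
      using C by (intro F.generate_subgroup_incl) auto
    then have "z \<otimes>\<^bsub>?W\<^esub> \<psi> u = \<psi> u \<otimes>\<^bsub>?W\<^esub> z" using gen u by auto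
    then have comm_u: "fst (z \<otimes>\<^bsub>?W\<^esub> \<psi> u) 0 = fst (\<psi> u \<otimes>\<^bsub>?W\<^esub> z) 0" by simp
    \<comment> \<open>Both sides are homomorphisms to the integers that agree on the factors: zero
      on \<open>U1\<close>, \<open>\<eta>\<close> on \<open>U2\<close>.\<close>
    have snd_\<psi>: "snd (\<psi> x) = \<eta> (\<rho> x)" if x: "x \<in> carrier F" for x
    proof (rule hom_eq_on_generators[OF F.group_axioms group_integer_group _ _ gen' UF _ x])
      show "(\<lambda>x. snd (\<psi> x)) \<in> hom F integer_group" by (auto intro!: homI)
      show "(\<lambda>x. \<eta> (\<rho> x)) \<in> hom F integer_group" using hom_compose[OF \<rho>_F \<eta>(1)] by (simp add: o_def)
      show "snd (\<psi> s) = \<eta> (\<rho> s)" if "s \<in> U1 \<union> U2" for s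
        using that \<rho>1 \<rho>2 \<psi>1 \<psi>2 \<eta>.hom_one by auto
    qed
    have "snd z = int n * \<eta> t"
      unfolding z_def using ab snd_\<psi> t by (simp add: \<rho>.hom_nat_pow \<eta>.hom_nat_pow t_def)
    then have "snd z \<noteq> 0" using n \<eta>t by simp
    \<comment> \<open>With \<open>z\<close> in front, position 0 reads \<open>\<psi> u\<close> at
      position \<open>snd z\<close>, which is not 0, so nothing is added; in the other order
      \<open>\<chi> u\<close> is added.\<close>
    then have "fst z 0 mod int n = (\<chi> u + fst z 0) mod int n"
      using comm_u \<psi>1[OF u(1)] by simp
    moreover have "\<chi> u \<in> {0..<int n}" using \<chi>c[of u] u n by (simp add: carrier_integer_mod_group)
    ultimately have "\<chi> u mod int n = 0" by (metis add_diff_cancel_right' diff_self mod_0 mod_diff_cong)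
    then show False using u \<open>\<chi> u \<in> {0..<int n}\<close> by simp
  qed
qed

section \<open>Free products from free bases\<close>

lemma word_val_carrier_update:
  assumes "group G" "subgroup H G" "fst ` set w \<subseteq> H"
  shows "word_val (G\<lparr>carrier := H\<rparr>) w = word_val G w"
proof -
  interpret group G by fact
  show ?thesis using assms(3)
    by (induction w) (auto simp: word_val_def letter_val_def m_inv_consistent[OF assms(2)])
qed

lemma (in group) free_basis_subgroup:
  assumes "S \<subseteq> carrier G"
    and "\<And>w. w \<noteq> [] \<Longrightarrow> fst ` set w \<subseteq> S \<Longrightarrow> reduced_word w \<Longrightarrow> word_val G w \<noteq> \<one>"
  shows "free_basis (G\<lparr>carrier := generate G S\<rparr>) S"
proof -
  have S: "S \<subseteq> generate G S" by (auto intro: generate.incl)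
  have H: "subgroup (generate G S) G" using generate_is_subgroup[OF assms(1)] .
  have "word_val (G\<lparr>carrier := generate G S\<rparr>) w \<noteq> \<one>"
    if w: "w \<noteq> []" "fst ` set w \<subseteq> S" "reduced_word w" for w
    using word_val_carrier_update[OF group_axioms H, of w] assms(2)[OF w] w(2) S by auto
  then show ?thesis
    using S generate_consistent[OF S H] by (auto simp: free_basis_def)
qed

text \<open>Each factor is replaced by its reduced word. Neighbouring words use disjoint parts of
  the basis, so nothing cancels where they meet and the concatenation is a nonempty reduced
  word.\<close>

lemma (in group) internal_free_product_of_free_basis:
  assumes basis: "free_basis G (S1 \<union> S2)" and disj: "S1 \<inter> S2 = {}"
  shows "internal_free_product G (generate G S1) (generate G S2)"
proof -
  let ?U1 = "generate G S1" and ?U2 = "generate G S2"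
  have S: "S1 \<subseteq> carrier G" "S2 \<subseteq> carrier G" "generate G (S1 \<union> S2) = carrier G"
    using basis by (auto simp: free_basis_def)
  have S12: "S1 \<union> S2 \<subseteq> carrier G" using S by simp
  have sub: "subgroup ?U1 G" "subgroup ?U2 G" using S generate_is_subgroup by auto
  have U: "?U1 \<union> ?U2 \<subseteq> carrier G" using S generate_incl by blast
  have "generate G (S1 \<union> S2) \<subseteq> generate G (?U1 \<union> ?U2)"
    by (intro mono_generate) (auto intro: generate.incl)
  then have gen: "generate G (?U1 \<union> ?U2) = carrier G" using S generate_incl[OF U] by blast
  have factor: "\<exists>w. w \<noteq> [] \<and> reduced_word w \<and> word_val G w = x \<and> fst ` set w \<subseteq> T"
    if "x \<in> generate G T" "T \<subseteq> carrier G" "x \<noteq> \<one>" for x T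
    using generate_reduced_word[OF that(2,1)] that(3) by (metis word_val_Nil)
  \<comment> \<open>A common nontrivial element would have reduced words over \<open>S1\<close> and
    over \<open>S2\<close>; these would be equal by uniqueness, but the alphabets are
    disjoint.\<close>
  have "x = \<one>" if x: "x \<in> ?U1" "x \<in> ?U2" for x
  proof (rule ccontr)
    assume "x \<noteq> \<one>"
    then obtain u v where u: "u \<noteq> []" "reduced_word u" "word_val G u = x" "fst ` set u \<subseteq> S1"
      and v: "reduced_word v" "word_val G v = x" "fst ` set v \<subseteq> S2"
      using factor[OF x(1) S(1)] factor[OF x(2) S(2)] by metis
    have "u = v" by (rule reduced_word_unique[OF basis]) (use u v in auto)
    then have "fst (hd u) \<in> S1 \<inter> S2" using u v by (auto intro: hd_in_set)
    then show False using disj by simp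
  qed
  then have factor: "\<exists>w. w \<noteq> [] \<and> reduced_word w \<and> word_val G w = x \<and>
      (x \<in> ?U1 \<longrightarrow> fst ` set w \<subseteq> S1) \<and> (x \<in> ?U2 \<longrightarrow> fst ` set w \<subseteq> S2)"
    if "x \<in> ?U1 \<union> ?U2" "x \<noteq> \<one>" for x
    using that factor[of x S1] factor[of x S2] S by blast
  \<comment> \<open>The first letter is tracked because it decides whether another word can be
    prepended without cancellation.\<close>
  have nf: "\<exists>w. w \<noteq> [] \<and> reduced_word w \<and> word_val G w = list_prod G xs \<and> fst ` set w \<subseteq> S1 \<union> S2 \<and>
       (hd xs \<in> ?U1 \<longrightarrow> fst (hd w) \<in> S1) \<and> (hd xs \<in> ?U2 \<longrightarrow> fst (hd w) \<in> S2)"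
    if "xs \<noteq> []" "set xs \<subseteq> (?U1 \<union> ?U2) - {\<one>}"
      "successively (\<lambda>x y. (x \<in> ?U1 \<and> y \<in> ?U2) \<or> (x \<in> ?U2 \<and> y \<in> ?U1)) xs" for xs
    using that
  proof (induction xs)
    case (Cons x xs)
    then have x: "x \<in> ?U1 \<union> ?U2" "x \<noteq> \<one>" "x \<in> carrier G" using U by auto
    obtain u where u: "u \<noteq> []" "reduced_word u" "word_val G u = x"
      and u12: "x \<in> ?U1 \<Longrightarrow> fst ` set u \<subseteq> S1" "x \<in> ?U2 \<Longrightarrow> fst ` set u \<subseteq> S2"
      using factor[OF x(1,2)] by blast
    have uS: "fst ` set u \<subseteq> S1 \<union> S2" using u12 x(1) by blast
    have hd_u: "x \<in> ?U1 \<Longrightarrow> fst (hd u) \<in> S1" "x \<in> ?U2 \<Longrightarrow> fst (hd u) \<in> S2"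
      and last_u: "x \<in> ?U1 \<Longrightarrow> fst (last u) \<in> S1" "x \<in> ?U2 \<Longrightarrow> fst (last u) \<in> S2"
      using u12 u(1) by (meson hd_in_set last_in_set image_subset_iff)+
    show ?case
    proof (cases "xs = []")
      case True
      then show ?thesis using u uS hd_u x(3) by (intro exI[of _ u]) simp
    next
      case False
      then have alt: "(x \<in> ?U1 \<and> hd xs \<in> ?U2) \<or> (x \<in> ?U2 \<and> hd xs \<in> ?U1)"
        using Cons.prems by (simp add: successively_Cons)
      have "set xs \<subseteq> ?U1 \<union> ?U2 - {\<one>}"
        "successively (\<lambda>x y. (x \<in> ?U1 \<and> y \<in> ?U2) \<or> (x \<in> ?U2 \<and> y \<in> ?U1)) xs"
        using False Cons.prems(2,3) by (simp_all add: successively_Cons)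
      from Cons.IH[OF False this]
      obtain w where w: "w \<noteq> []" "reduced_word w" "word_val G w = list_prod G xs" "fst ` set w \<subseteq> S1 \<union> S2"
        "hd xs \<in> ?U1 \<Longrightarrow> fst (hd w) \<in> S1" "hd xs \<in> ?U2 \<Longrightarrow> fst (hd w) \<in> S2"
        by blast
      have "fst (last u) \<noteq> fst (hd w)" using alt last_u w(5,6) disj by (metis disjoint_iff)
      then have "reduced_word (u @ w)" using u w by (simp add: reduced_word_append_iff)
      moreover have "word_val G (u @ w) = list_prod G (x # xs)"
        using u(3) w(3) word_val_append[OF subset_trans[OF uS S12] subset_trans[OF w(4) S12]] by simp
      moreover have "fst ` set (u @ w) \<subseteq> S1 \<union> S2" using uS w(4) by auto
      ultimately show ?thesis using u(1) hd_u by (intro exI[of _ "u @ w"]) simp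
    qed
  qed simp
  have "list_prod G xs \<noteq> \<one>"
    if "xs \<noteq> []" "set xs \<subseteq> (?U1 \<union> ?U2) - {\<one>}"
      "successively (\<lambda>x y. (x \<in> ?U1 \<and> y \<in> ?U2) \<or> (x \<in> ?U2 \<and> y \<in> ?U1)) xs" for xs
    using nf[OF that] basis unfolding free_basis_def by metis
  then show ?thesis unfolding internal_free_product_def using sub gen by blast
qed

section \<open>A free basis of the subgroup of words of even length\<close>

text \<open>Elements whose reduced form begins with c^e, where e is the full exponent: the rest
  starts neither with \<open>c\<close> nor with its inverse. Exponent 0 is allowed, so that
  exponents can be added freely.\<close>

definition syllable :: "('g, 'm) monoid_scheme \<Rightarrow> 'g set \<Rightarrow> 'g \<Rightarrow> int \<Rightarrow> 'g set" where
  "syllable G S c e = {c [^]\<^bsub>G\<^esub> e \<otimes>\<^bsub>G\<^esub> word_val G w | w.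
     fst ` set w \<subseteq> S \<and> reduced_word w \<and> (w \<noteq> [] \<longrightarrow> fst (hd w) \<noteq> c)}"

context group
begin

lemma int_pow_eq_word_val:
  assumes "c \<in> carrier G"
  shows "c [^] (e::int) = word_val G (replicate (nat \<bar>e\<bar>) (c, e > 0))"
proof -
  have "word_val G (replicate k (c, e > 0)) = letter_val G (c, e > 0) [^] k" for k
    using assms by (simp add: word_val_def list_prod_replicate)
  then have *: "word_val G (replicate (nat \<bar>e\<bar>) (c, e > 0)) = letter_val G (c, e > 0) [^] nat \<bar>e\<bar>" .
  show ?thesis
  proof (cases "e > 0")
    case True
    then have "nat \<bar>e\<bar> = nat e" "\<not> e < 0" "letter_val G (c, e > 0) = c" by (simp_all add: letter_val_def)
    then show ?thesis unfolding * int_pow_def2 by simp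
  next
    case False
    then have "letter_val G (c, e > 0) = inv c" by (simp add: letter_val_def)
    then have "word_val G (replicate (nat \<bar>e\<bar>) (c, e > 0)) = inv (c [^] nat \<bar>e\<bar>)"
      unfolding * using nat_pow_inv[OF assms] by simp
    moreover have "c [^] (- int (nat \<bar>e\<bar>)) = inv (c [^] nat \<bar>e\<bar>)" by (rule int_pow_neg_int[OF assms])
    moreover have "- int (nat \<bar>e\<bar>) = e" using False by simp
    ultimately show ?thesis by (simp only:)
  qed
qed

text \<open>The nonzero power is a nonempty block of one repeated letter, followed by a different
  generator or by nothing, so the joined word stays reduced.\<close>

lemma syllable_reduced_word:
  assumes S: "S \<subseteq> carrier G" and c: "c \<in> S" and e: "e \<noteq> 0" and z: "z \<in> syllable G S c e"
  obtains w where "w \<noteq> []" "fst ` set w \<subseteq> S" "reduced_word w" "fst (hd w) = c" "word_val G w = z"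
proof -
  obtain w where w: "z = c [^] e \<otimes> word_val G w" "fst ` set w \<subseteq> S" "reduced_word w"
      "w \<noteq> [] \<longrightarrow> fst (hd w) \<noteq> c"
    using z unfolding syllable_def by blast
  define u where "u = replicate (nat \<bar>e\<bar>) (c, e > 0)"
  have u: "u \<noteq> []" "fst ` set u \<subseteq> S" "hd u = (c, e > 0)" "last u = (c, e > 0)" "reduced_word u"
    using e c reduced_word_replicate by (auto simp: u_def)
  have "reduced_word (u @ w)" "fst (hd (u @ w)) = c"
    using w(3,4) u unfolding reduced_word_append_iff by (simp_all, metis)
  moreover have "word_val G (u @ w) = z"
    using w(1) word_val_append[OF subset_trans[OF u(2) S] subset_trans[OF w(2) S]]
      int_pow_eq_word_val[of c e] c S by (auto simp: u_def)
  moreover have "fst ` set (u @ w) \<subseteq> S" using u(2) w(2) by (simp only: set_append image_Un Un_least)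
  ultimately show thesis using that[of "u @ w"] u(1) by simp
qed

lemma one_notin_syllable:
  assumes "free_basis G S" "c \<in> S" "e \<noteq> 0"
  shows "\<one> \<notin> syllable G S c e"
proof
  have S: "S \<subseteq> carrier G" using assms(1) by (simp add: free_basis_def)
  assume "\<one> \<in> syllable G S c e"
  then obtain w where "w \<noteq> []" "fst ` set w \<subseteq> S" "reduced_word w" "word_val G w = \<one>"
    by (rule syllable_reduced_word[OF S assms(2,3)])
  then show False using assms(1) unfolding free_basis_def by blast
qed

lemma int_pow_in_syllable: "c \<in> carrier G \<Longrightarrow> c [^] e \<in> syllable G S c e"
  unfolding syllable_def by (rule CollectI, rule exI[of _ "[]"]) simp

lemma syllable_int_pow_mult:
  assumes "S \<subseteq> carrier G" "c \<in> S" "z \<in> syllable G S c e"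
  shows "c [^] i \<otimes> z \<in> syllable G S c (i + e)"
proof -
  obtain w where w: "z = c [^] e \<otimes> word_val G w" "fst ` set w \<subseteq> S" "reduced_word w"
      "w \<noteq> [] \<longrightarrow> fst (hd w) \<noteq> c"
    using assms(3) unfolding syllable_def by blast
  have "word_val G w \<in> carrier G" by (rule word_val_closed[OF subset_trans[OF w(2) assms(1)]])
  moreover have "c \<in> carrier G" using assms by blast
  ultimately have "c [^] i \<otimes> z = c [^] (i + e) \<otimes> word_val G w"
    using w(1) by (simp add: int_pow_mult m_assoc)
  then show ?thesis using w unfolding syllable_def by blast
qed

text \<open>Because \<open>e \<noteq> 0\<close>, the reduced word of \<open>z\<close> really starts
  with \<open>d\<close>, so all of \<open>z\<close> can serve as the remainder behind c^i.\<close>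

lemma syllable_int_pow_cons:
  assumes S: "S \<subseteq> carrier G" and "c \<in> S" "d \<in> S" "d \<noteq> c" "e \<noteq> 0" "z \<in> syllable G S d e"
  shows "c [^] (i::int) \<otimes> z \<in> syllable G S c i"
proof -
  obtain w where "w \<noteq> []" "fst ` set w \<subseteq> S" "reduced_word w" "fst (hd w) = d" "word_val G w = z"
    using syllable_reduced_word[OF S assms(3,5,6)] .
  then show ?thesis using assms(4) unfolding syllable_def by blast
qed

end

text \<open>For odd \<open>\<mu>\<close>, the possible exponents \<open>e\<close> of the leading syllable \<open>c\<^sup>e\<close> of a product that starts
  with \<open>c\<^sup>2\<close> (if \<open>s\<close> holds) or its inverse: squares may be followed by a syllable \<open>c\<^sup>\<mu>\<close>.\<close>

definition square_exponent :: "int \<Rightarrow> bool \<Rightarrow> int \<Rightarrow> bool" where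
  "square_exponent \<mu> s e \<longleftrightarrow>
     (if s then e > (if even e then 0 else \<mu>) else e < (if even e then 0 else \<mu>))"

lemma square_exponent_shift:
  "square_exponent \<mu> s e \<Longrightarrow> square_exponent \<mu> s ((if s then 2 else -2) + e)"
  by (auto simp: square_exponent_def split: if_splits)

lemma square_exponent_start:
  "odd \<mu> \<Longrightarrow> square_exponent \<mu> s ((if s then 2 else -2) + \<mu>)"
  "square_exponent \<mu> s (if s then 2 else -2)"
  by (auto simp: square_exponent_def)

text \<open>Even exponents stay strictly on one side of 0 and odd ones strictly on one side of the
  odd number \<open>\<mu>\<close>; parity excludes the other value.\<close>

lemma square_exponent_neq: "odd \<mu> \<Longrightarrow> square_exponent \<mu> s e \<Longrightarrow> e \<noteq> 0 \<and> e \<noteq> \<mu>"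
  by (auto simp: square_exponent_def split: if_splits)

lemma (in group) nat_pow_in_generate: "c \<in> generate G S \<Longrightarrow> c [^] (k::nat) \<in> generate G S"
  by (induction k) (auto intro: generate.one generate.eng)

section \<open>Products of the two squares and the mixed element a^m b^m\<close>

locale free_rank_two = group F for F :: "('g, 'm) monoid_scheme" (structure) +
  fixes a b :: 'g
  assumes basis: "free_basis F {a, b}" and neq: "a \<noteq> b"
begin

lemma gens [simp]: "a \<in> carrier F" "b \<in> carrier F"
  using basis by (auto simp: free_basis_def)

abbreviation "syl \<equiv> syllable F {a, b}"

text \<open>The hypothesis lists what can stand behind a square in a reduced word: nothing, the
  syllable c^\<mu> of a mixed letter, an exponent reached by squares of the same sign, or a syllable
  of the other generator. Keeping \<open>c\<close> and \<open>d\<close> interchangeable covers both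
  squares.\<close>

lemma square_step:
  assumes cd: "{c, d} = {a, b}" "c \<noteq> d" and \<mu>: "odd \<mu>"
    and z: "z = \<one> \<or> z \<in> syl c \<mu> \<or> (\<exists>e. square_exponent \<mu> s e \<and> z \<in> syl c e) \<or> (\<exists>e. e \<noteq> 0 \<and> z \<in> syl d e)"
  shows "\<exists>e. square_exponent \<mu> s e \<and> letter_val F (c [^] (2::nat), s) \<otimes> z \<in> syl c e"
proof -
  let ?i = "if s then 2 else - 2 :: int"
  have c: "c \<in> carrier F" "c \<in> {a, b}" "d \<in> {a, b}" using cd(1) gens by (auto simp: doubleton_eq_iff)
  have S: "{a, b} \<subseteq> carrier F" by simp
  have l: "letter_val F (c [^] (2::nat), s) = c [^] ?i"
    using c int_pow_int[of F c 2] int_pow_neg_int[of c 2] by (simp add: letter_val_def)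
  from z consider "z = \<one>" | "z \<in> syl c \<mu>" | e where "square_exponent \<mu> s e" "z \<in> syl c e"
    | e where "e \<noteq> 0" "z \<in> syl d e" by blast
  then show ?thesis
  proof cases
    case 1
    then show ?thesis unfolding l using int_pow_in_syllable[OF c(1), of ?i "{a, b}"] square_exponent_start(2) c by fastforce
  next
    case 2
    then show ?thesis unfolding l using syllable_int_pow_mult[OF S c(2) 2, of ?i] square_exponent_start(1)[OF \<mu>] by blast
  next
    case 3
    then show ?thesis unfolding l using syllable_int_pow_mult[OF S c(2) 3(2), of ?i] square_exponent_shift by blast
  next
    case 4
    then show ?thesis unfolding l
      using syllable_int_pow_cons[OF S c(2,3) cd(2)[symmetric] 4, of ?i] square_exponent_start(2) by blast
  qed
qed

text \<open>Excluding the exponent -\<nu> keeps the middle syllable of \<open>d\<close> from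
  disappearing, and this shields c^\<mu> from \<open>z\<close>. Taking a, b, m, m or b, a, -m, -m
  for c, d, \<mu>, \<nu> gives the mixed element or its inverse.\<close>

lemma mixed_step:
  assumes cd: "{c, d} = {a, b}" "c \<noteq> d" and \<nu>: "\<nu> \<noteq> 0"
    and z: "z = \<one> \<or> (\<exists>e. e \<noteq> 0 \<and> z \<in> syl c e) \<or> (\<exists>e. e \<noteq> 0 \<and> e \<noteq> - \<nu> \<and> z \<in> syl d e)"
  shows "c [^] (\<mu>::int) \<otimes> (d [^] (\<nu>::int) \<otimes> z) \<in> syl c \<mu>"
proof -
  have c: "c \<in> carrier F" "c \<in> {a, b}" "d \<in> carrier F" "d \<in> {a, b}"
    using cd(1) gens by (auto simp: doubleton_eq_iff)
  have S: "{a, b} \<subseteq> carrier F" by simp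
  from z consider "z = \<one>" | e where "e \<noteq> 0" "z \<in> syl c e"
    | e where "e \<noteq> 0" "e \<noteq> - \<nu>" "z \<in> syl d e" by blast
  then have "\<exists>e. e \<noteq> 0 \<and> d [^] \<nu> \<otimes> z \<in> syl d e"
  proof cases
    case 1
    then show ?thesis using int_pow_in_syllable[OF c(3), of \<nu> "{a, b}"] \<nu> c by auto
  next
    case 2
    then show ?thesis using syllable_int_pow_cons[OF S c(4,2) cd(2) 2, of \<nu>] \<nu> by blast
  next
    case 3
    have "\<nu> + e \<noteq> 0" using 3 by simp
    then show ?thesis using syllable_int_pow_mult[OF S c(4) 3(3), of \<nu>] by blast
  qed
  then show ?thesis using syllable_int_pow_cons[OF S c(2,4) cd(2)[symmetric]] by blast
qed

text \<open>The three elements have the values 2, -2 and 0 under \<open>\<eta>\<close>.\<close>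

lemma squares_mixed_distinct:
  "a [^] (2::nat) \<noteq> b [^] (2::nat)"
  "a [^] m \<otimes> b [^] m \<noteq> a [^] (2::nat)" "a [^] m \<otimes> b [^] m \<noteq> b [^] (2::nat)" for m :: nat
proof -
  obtain \<eta> where \<eta>: "\<eta> \<in> hom F integer_group" "\<eta> a = 1" "\<eta> b = -1" by (rule exponent_difference_hom[OF group_axioms neq basis])
  interpret \<eta>: group_hom F integer_group \<eta>
    using \<eta>(1) by (intro group_hom.intro group_hom_axioms.intro) (simp_all add: group_axioms)
  have "\<eta> (a [^] (2::nat)) = 2" "\<eta> (b [^] (2::nat)) = -2" "\<eta> (a [^] m \<otimes> b [^] m) = 0"
    using \<eta> by (simp_all add: \<eta>.hom_nat_pow)
  then have "\<eta> (a [^] (2::nat)) \<noteq> \<eta> (b [^] (2::nat))"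
    "\<eta> (a [^] m \<otimes> b [^] m) \<noteq> \<eta> (a [^] (2::nat))" "\<eta> (a [^] m \<otimes> b [^] m) \<noteq> \<eta> (b [^] (2::nat))"
    by linarith+
  then show "a [^] (2::nat) \<noteq> b [^] (2::nat)"
    "a [^] m \<otimes> b [^] m \<noteq> a [^] (2::nat)" "a [^] m \<otimes> b [^] m \<noteq> b [^] (2::nat)" by metis+
qed

text \<open>Letters are prepended one at a time, and the leading syllable survives. A leading square
  of \<open>a\<close> merges only with further such squares and the a^m of the mixed element, one of
  \<open>b\<close> only with further such squares and the b^(-m) of its inverse; as \<open>m\<close>
  is odd, merged exponents never vanish.\<close>

lemma word_val_squares_mixed:
  fixes m :: nat
  defines "x \<equiv> a [^] (2::nat)" and "y \<equiv> b [^] (2::nat)" and "t \<equiv> a [^] m \<otimes> b [^] m"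
  assumes m: "odd m"
  shows "w \<noteq> [] \<Longrightarrow> fst ` set w \<subseteq> {x, y, t} \<Longrightarrow> reduced_word w \<Longrightarrow>
    (fst (hd w) = x \<longrightarrow> (\<exists>e. square_exponent (int m) (snd (hd w)) e \<and> word_val F w \<in> syl a e)) \<and>
    (fst (hd w) = y \<longrightarrow> (\<exists>e. square_exponent (- int m) (snd (hd w)) e \<and> word_val F w \<in> syl b e)) \<and>
    (fst (hd w) = t \<longrightarrow> word_val F w \<in> (if snd (hd w) then syl a (int m) else syl b (- int m)))"
proof (induction w)
  case (Cons l w)
  have dist: "x \<noteq> y" "t \<noteq> x" "t \<noteq> y" unfolding x_def y_def t_def by (rule squares_mixed_distinct)+
  have odd: "odd (int m)" "odd (- int m)" using m by simp_all
  have m0: "int m \<noteq> 0" "- int m \<noteq> 0" using m by (auto elim: oddE)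
  let ?z = "word_val F w"
  have Sc: "fst ` set w \<subseteq> carrier F"
    using Cons.prems(2) by (auto simp: x_def y_def t_def)
  then have z: "?z \<in> carrier F" by simp
  obtain g s where l: "l = (g, s)" by (cases l)
  have red: "w \<noteq> [] \<Longrightarrow> fst (hd w) = g \<Longrightarrow> snd (hd w) = s" "reduced_word w"
    using Cons.prems(3) l by (auto simp: reduced_word_Cons)
  \<comment> \<open>The next letter decides the leading syllable of the rest. Each case also records
    the sign condition that reducedness imposes on the new letter.\<close>
  consider (Nil) "?z = \<one>"
    | (x) e where "square_exponent (int m) (snd (hd w)) e" "?z \<in> syl a e" "g = x \<longrightarrow> snd (hd w) = s"
    | (y) e where "square_exponent (- int m) (snd (hd w)) e" "?z \<in> syl b e" "g = y \<longrightarrow> snd (hd w) = s"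
    | (t) "?z \<in> syl a (int m)" "g = t \<longrightarrow> s"
    | (t') "?z \<in> syl b (- int m)" "g = t \<longrightarrow> \<not> s"
  proof (cases "w = []")
    case False
    then have "fst (hd w) \<in> {x, y, t}" using Cons.prems(2) by (cases w) auto
    moreover have "fst ` set w \<subseteq> {x, y, t}" using Cons.prems(2) by simp
    note Cons.IH[OF False this red(2)]
    ultimately show thesis using that(2-5) red(1)[OF False]
      by (cases "snd (hd w)") (auto split: if_splits)
  qed (use that in simp)
  note st = this
  have g: "g \<in> {x, y, t}" using Cons.prems(2) l by simp
  then consider "g = x" | "g = y" | "g = t" by blast
  then show ?case
  proof cases
    case 1
    have "?z = \<one> \<or> ?z \<in> syl a (int m) \<or> (\<exists>e. square_exponent (int m) s e \<and> ?z \<in> syl a e) \<or> (\<exists>e. e \<noteq> 0 \<and> ?z \<in> syl b e)"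
      using st
    proof cases
      case (y e)
      then show ?thesis using square_exponent_neq[OF odd(2) y(1)] by blast
    qed (use 1 m0 in blast)+
    from square_step[OF _ neq odd(1) this] show ?thesis using 1 dist l by (simp add: x_def)
  next
    case 2
    have "?z = \<one> \<or> ?z \<in> syl b (- int m) \<or> (\<exists>e. square_exponent (- int m) s e \<and> ?z \<in> syl b e) \<or> (\<exists>e. e \<noteq> 0 \<and> ?z \<in> syl a e)"
      using st
    proof cases
      case (x e)
      then show ?thesis using square_exponent_neq[OF odd(1) x(1)] by blast
    qed (use 2 m0 in blast)+
    from square_step[OF _ neq[symmetric] odd(2) this] show ?thesis using 2 dist l by (simp add: y_def insert_commute)
  next
    case 3
    show ?thesis
    proof (cases s)
      case True
      \<comment> \<open>The trailing b^m could vanish only against b^(-m): squares of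
        \<open>b\<close> never reach this exponent, and reducedness excludes the inverse of the
        mixed element.\<close>
      have "?z = \<one> \<or> (\<exists>e. e \<noteq> 0 \<and> ?z \<in> syl a e) \<or> (\<exists>e. e \<noteq> 0 \<and> e \<noteq> - int m \<and> ?z \<in> syl b e)"
        using st
      proof cases
        case (x e)
        then show ?thesis using square_exponent_neq[OF odd(1) x(1)] by blast
      next
        case (y e)
        then show ?thesis using square_exponent_neq[OF odd(2) y(1)] by blast
      qed (use 3 True m0 in blast)+
      from mixed_step[OF _ neq m0(1) this, of "int m"]
      show ?thesis using 3 True dist l z by (simp add: letter_val_def t_def int_pow_int m_assoc)
    next
      case False
      have "?z = \<one> \<or> (\<exists>e. e \<noteq> 0 \<and> ?z \<in> syl b e) \<or> (\<exists>e. e \<noteq> 0 \<and> e \<noteq> - (- int m) \<and> ?z \<in> syl a e)"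
        using st
      proof cases
        case (x e)
        then show ?thesis using square_exponent_neq[OF odd(1) x(1)] by auto
      next
        case (y e)
        then show ?thesis using square_exponent_neq[OF odd(2) y(1)] by blast
      qed (use 3 False m0 in blast)+
      from mixed_step[OF _ neq[symmetric] m0(2) this, of "- int m"]
      show ?thesis using 3 False dist l z
        by (simp add: letter_val_def t_def int_pow_neg_int inv_mult_group m_assoc insert_commute)
    qed
  qed
qed simp

lemma free_basis_squares_mixed:
  fixes m :: nat
  assumes m: "odd m"
  defines "S \<equiv> {a [^] (2::nat), b [^] (2::nat), a [^] m \<otimes> b [^] m}"
  shows "free_basis (F\<lparr>carrier := generate F S\<rparr>) S"
proof (rule free_basis_subgroup)
  show "S \<subseteq> carrier F" by (simp add: S_def)
  fix w assume w: "w \<noteq> []" "fst ` set w \<subseteq> S" "reduced_word w"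
  have odd: "odd (int m)" "odd (- int m)" using m by simp_all
  have m0: "int m \<noteq> 0" "- int m \<noteq> 0" using odd_pos[OF m] by simp_all
  note cases = word_val_squares_mixed[OF m w(1) w(2)[unfolded S_def] w(3)]
  have "fst (hd w) \<in> S" using w(1,2) by (simp add: image_subset_iff)
  then consider "fst (hd w) = a [^] (2::nat)" | "fst (hd w) = b [^] (2::nat)"
    | "fst (hd w) = a [^] m \<otimes> b [^] m"
    unfolding S_def by blast
  then have "\<exists>c e. c \<in> {a, b} \<and> e \<noteq> 0 \<and> word_val F w \<in> syl c e"
  proof cases
    case 1
    then show ?thesis using cases square_exponent_neq[OF odd(1)] by blast
  next
    case 2
    then show ?thesis using cases square_exponent_neq[OF odd(2)] by blast
  next
    case 3
    then have "word_val F w \<in> (if snd (hd w) then syl a (int m) else syl b (- int m))"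
      using cases by blast
    then show ?thesis using m0 by (cases "snd (hd w)") (simp_all only: if_True if_False, blast+)
  qed
  then show "word_val F w \<noteq> \<one>" using one_notin_syllable[OF basis] by metis
qed

text \<open>\<open>K\<close> contains a^2, b^2 and ab, so right multiplication by generators and
  their inverses preserves the union of \<open>K\<close> and its coset of \<open>a\<close>; the
  parity of \<open>\<eta>\<close> keeps \<open>a\<close> outside \<open>K\<close>.\<close>

lemma rcosets_squares_mixed:
  fixes m :: nat
  assumes m: "odd m"
  defines "K \<equiv> generate F {a [^] (2::nat), b [^] (2::nat), a [^] m \<otimes> b [^] m}"
  shows "finite (rcosets K)" "card (rcosets K) = 2"
proof -
  let ?S = "{a [^] (2::nat), b [^] (2::nat), a [^] m \<otimes> b [^] m}"
  have S: "?S \<subseteq> carrier F" by simp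
  have K: "subgroup K F" unfolding K_def by (rule generate_is_subgroup[OF S])
  interpret K: subgroup K F by fact
  have Kc: "k \<in> carrier F" if "k \<in> K" for k using that by (rule K.mem_carrier)
  obtain \<eta> where \<eta>: "\<eta> \<in> hom F integer_group" "\<eta> a = 1" "\<eta> b = -1" by (rule exponent_difference_hom[OF group_axioms neq basis])
  interpret \<eta>: group_hom F integer_group \<eta>
    using \<eta>(1) by (intro group_hom.intro group_hom_axioms.intro) (simp_all add: group_axioms)
  have "even (\<eta> k)" if "k \<in> K" for k
    using that unfolding K_def
  proof (induction rule: generate.induct)
    case (incl h)
    then show ?case using \<eta> by (auto simp: \<eta>.hom_nat_pow)
  next
    case (inv h)
    then show ?case using \<eta> by (auto simp: \<eta>.hom_nat_pow)
  next
    case (eng h1 h2)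
    then show ?case using generate_in_carrier[OF S] by simp
  qed simp
  then have aK: "a \<notin> K" using \<eta> by force
  have sq: "a \<otimes> a \<in> K" "b \<otimes> b \<in> K" and mixed: "a [^] m \<otimes> b [^] m \<in> K"
    using generate.incl[of _ ?S F] by (auto simp: K_def numeral_2_eq_2)
  have pow_even: "c [^] (2 * k) \<in> K" if c: "c \<in> {a, b}" for c and k :: nat
  proof -
    have "(c [^] (2::nat)) [^] k \<in> K"
      using c unfolding K_def by (intro nat_pow_in_generate generate.incl) auto
    moreover have "c \<in> carrier F" using c by auto
    ultimately show ?thesis by (simp add: nat_pow_pow)
  qed
  obtain j where j: "m = 2 * j + 1" using m by (auto elim: oddE)
  \<comment> \<open>Taking the even powers off both ends of a^m b^m leaves ab.\<close>
  have "a [^] m \<otimes> b [^] m = a [^] (2 * j) \<otimes> (a \<otimes> b) \<otimes> b [^] (2 * j)"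
    using nat_pow_Suc2[of b "2 * j"] by (simp add: j m_assoc)
  then have "a \<otimes> b = inv (a [^] (2 * j)) \<otimes> (a [^] m \<otimes> b [^] m) \<otimes> inv (b [^] (2 * j))"
    by (simp add: m_assoc inv_solve_left inv_solve_right')
  then have ab: "a \<otimes> b \<in> K" using mixed pow_even by simp
  have "b \<otimes> inv a = (b \<otimes> b) \<otimes> inv (a \<otimes> b)"
    by (simp add: inv_mult_group m_assoc) (simp add: m_assoc[symmetric])
  then have ba: "b \<otimes> inv a \<in> K" using sq ab by simp
  have split: "x \<in> K \<or> x \<otimes> inv a \<in> K" if "x \<in> carrier F" for x
  proof -
    have gen: "x \<in> generate F {a, b}" using that basis by (simp add: free_basis_def)
    have K_mult: "k \<in> K" if "k' \<in> K" "k'' \<in> K" "k = k' \<otimes> k''" for k k' k''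
      using that by simp
    \<comment> \<open>Quantifying over a left factor \<open>k\<close> turns the claim into closure
      under right multiplication by \<open>x\<close>, which passes to products; at the end
      \<open>k\<close> is the identity.\<close>
    have "\<forall>k\<in>carrier F. k \<in> K \<or> k \<otimes> inv a \<in> K \<longrightarrow> k \<otimes> x \<in> K \<or> k \<otimes> x \<otimes> inv a \<in> K"
      using gen
    proof (induction rule: generate.induct)
      case one
      then show ?case by simp
    next
      case (incl h)
      show ?case
      proof (intro ballI impI)
        fix k assume k: "k \<in> carrier F" "k \<in> K \<or> k \<otimes> inv a \<in> K"
        have "k \<otimes> a \<otimes> inv a = k" "k \<otimes> a = (k \<otimes> inv a) \<otimes> (a \<otimes> a)"
          "k \<otimes> b \<otimes> inv a = k \<otimes> (b \<otimes> inv a)" "k \<otimes> b = (k \<otimes> inv a) \<otimes> (a \<otimes> b)"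
          using k(1) by (simp_all add: m_assoc inv_solve_left' flip: m_assoc[of "inv a" a])
        then show "k \<otimes> h \<in> K \<or> k \<otimes> h \<otimes> inv a \<in> K"
          using incl k(2) sq(1) ab ba K_mult by (metis insertE singletonD)
      qed
    next
      case (inv h)
      show ?case
      proof (intro ballI impI)
        fix k assume k: "k \<in> carrier F" "k \<in> K \<or> k \<otimes> inv a \<in> K"
        have "k \<otimes> inv a \<otimes> inv a = k \<otimes> inv (a \<otimes> a)"
          "k \<otimes> inv b \<otimes> inv a = k \<otimes> inv (a \<otimes> b)" "k \<otimes> inv b = (k \<otimes> inv a) \<otimes> inv (b \<otimes> inv a)"
          using k(1) by (simp_all add: inv_mult_group m_assoc flip: m_assoc[of "inv a" a])
        moreover have "inv (a \<otimes> a) \<in> K" "inv (a \<otimes> b) \<in> K" "inv (b \<otimes> inv a) \<in> K"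
          using sq ab ba by blast+
        ultimately show "k \<otimes> inv h \<in> K \<or> k \<otimes> inv h \<otimes> inv a \<in> K"
          using inv k(2) K_mult by (metis insertE singletonD)
      qed
    next
      case (eng h1 h2)
      have "{a, b} \<subseteq> carrier F" by simp
      then have h: "h1 \<in> carrier F" "h2 \<in> carrier F" using eng.hyps generate_in_carrier by blast+
      show ?case
      proof (intro ballI impI)
        fix k assume k: "k \<in> carrier F" "k \<in> K \<or> k \<otimes> inv a \<in> K"
        then have "k \<otimes> h1 \<in> K \<or> k \<otimes> h1 \<otimes> inv a \<in> K" using eng.IH(1) by blast
        then have "k \<otimes> h1 \<otimes> h2 \<in> K \<or> k \<otimes> h1 \<otimes> h2 \<otimes> inv a \<in> K" using eng.IH(2) k h by blast
        then show "k \<otimes> (h1 \<otimes> h2) \<in> K \<or> k \<otimes> (h1 \<otimes> h2) \<otimes> inv a \<in> K"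
          using k h by (simp add: m_assoc)
      qed
    qed
    from this[rule_format, OF one_closed] show ?thesis using that by simp
  qed
  have cosets: "rcosets K = {K, K #> a}"
  proof
    show "{K, K #> a} \<subseteq> rcosets K"
      using rcosetsI[OF K.subset one_closed] rcosetsI[OF K.subset, of a] coset_mult_one[OF K.subset] by simp
    show "rcosets K \<subseteq> {K, K #> a}"
    proof
      fix C assume "C \<in> rcosets K"
      then obtain x where x: "x \<in> carrier F" "C = K #> x" by (auto simp: RCOSETS_def)
      from split[OF x(1)] show "C \<in> {K, K #> a}"
      proof
        assume "x \<in> K"
        then show ?thesis using coset_join2[OF x(1) K] x by simp
      next
        assume "x \<otimes> inv a \<in> K"
        then have "(x \<otimes> inv a) \<otimes> a \<in> K #> a" by (intro rcosI K.subset) auto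
        then have "x \<in> K #> a" using x by (simp add: m_assoc)
        then show ?thesis using repr_independence[OF _ _ K, of x a] x by simp
      qed
    qed
  qed
  have "K \<noteq> K #> a" using aK coset_join1[OF _ _ K, of a] by auto
  then show "finite (rcosets K)" "card (rcosets K) = 2" using cosets by simp_all
qed

end

section \<open>The simplicity index\<close>

text \<open>The first factor is nontrivial because of \<open>g\<close>, the second because the basis
  element \<open>s\<close> is a one-letter reduced word.\<close>

lemma simple_in_of_free_basis:
  assumes "group G" and basis: "free_basis G (S1 \<union> S2)" and disj: "S1 \<inter> S2 = {}"
    and s: "s \<in> S2" and g: "g \<in> generate G S1" "g \<noteq> \<one>\<^bsub>G\<^esub>"
  shows "simple_in G g"
proof -
  interpret group G by fact
  have "word_val G [(s, True)] \<noteq> \<one>\<^bsub>G\<^esub>"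
    using basis s unfolding free_basis_def
    by (elim conjE allE[of _ "[(s, True)]"]) (simp add: reduced_word_Cons)
  moreover have "s \<in> carrier G" using basis s by (auto simp: free_basis_def)
  ultimately have "s \<noteq> \<one>\<^bsub>G\<^esub>" by (simp add: letter_val_def)
  moreover have "s \<in> generate G S2" using s by (rule generate.incl)
  ultimately show ?thesis
    using g internal_free_product_of_free_basis[OF basis disj] unfolding simple_in_def by blast
qed

lemma (in group) subgroup_eq_carrier_of_card_rcosets:
  assumes H: "subgroup H G" and "card (rcosets H) = 1"
  shows "H = carrier G"
proof
  show "H \<subseteq> carrier G" using H by (rule subgroup.subset)
  obtain C where C: "rcosets H = {C}" using assms(2) by (auto simp: card_1_singleton_iff)
  show "carrier G \<subseteq> H"
  proof
    fix x assume x: "x \<in> carrier G"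
    have "H #> x \<in> rcosets H" "H #> \<one> \<in> rcosets H"
      using rcosetsI[OF subgroup.subset[OF H]] x by blast+
    then have "H #> x = H" using C coset_mult_one[OF subgroup.subset[OF H]] by auto
    then show "x \<in> H" using x H by (rule coset_join1)
  qed
qed

section \<open>The powers a^n b^n in the subgroup of index two\<close>

context free_rank_two
begin

text \<open>Applied to the identity, \<open>mixed_step\<close> gives the leading syllable
  a^n.\<close>

lemma mixed_power_neq_one:
  assumes "n > 0"
  shows "a [^] (n::nat) \<otimes> b [^] n \<noteq> \<one>"
proof -
  have "a [^] int n \<otimes> (b [^] int n \<otimes> \<one>) \<in> syl a (int n)"
    using assms by (intro mixed_step neq) auto
  then show ?thesis using one_notin_syllable[OF basis, of a "int n"] assms by (auto simp: int_pow_int)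
qed

lemma mixed_power_simple_in_index_two:
  fixes n :: nat
  assumes n: "n > 0"
  obtains H where "subgroup H F" "finite (rcosets H)" "card (rcosets H) = 2"
    "a [^] n \<otimes> b [^] n \<in> H" "simple_in (F\<lparr>carrier := H\<rparr>) (a [^] n \<otimes> b [^] n)"
proof -
  \<comment> \<open>For odd \<open>n\<close> the element itself becomes a basis element. For even
    \<open>n\<close> it is a product of squares, and the mixed element spans the complementary
    factor; 1 is then the simplest odd exponent.\<close>
  define m where "m = (if odd n then n else 1)"
  have m: "odd m" by (simp add: m_def)
  let ?x = "a [^] (2::nat)" and ?y = "b [^] (2::nat)" and ?t = "a [^] m \<otimes> b [^] m"
    and ?g = "a [^] n \<otimes> b [^] n"
  let ?S = "{?x, ?y, ?t}"
  let ?H = "generate F ?S"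
  have H: "subgroup ?H F" by (rule generate_is_subgroup) simp
  have S: "?S \<subseteq> ?H" by (auto intro: generate.incl)
  interpret H: group "F\<lparr>carrier := ?H\<rparr>" by (rule subgroup_imp_group[OF H])
  note basis_H = free_basis_squares_mixed[OF m]
  have gen_H: "generate (F\<lparr>carrier := ?H\<rparr>) T = generate F T" if "T \<subseteq> ?S" for T
    using that S by (intro generate_consistent H) blast
  have "?g \<in> ?H \<and> simple_in (F\<lparr>carrier := ?H\<rparr>) ?g"
  proof (cases "odd n")
    case True
    then have g: "?g = ?t" by (simp add: m_def)
    have "?S = {?t} \<union> {?x, ?y}" by blast
    then have "free_basis (F\<lparr>carrier := ?H\<rparr>) ({?t} \<union> {?x, ?y})" using basis_H by simp
    moreover have "{?t} \<inter> {?x, ?y} = {}" using squares_mixed_distinct(2,3)[of m] by simp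
    moreover have "?g \<in> generate (F\<lparr>carrier := ?H\<rparr>) {?t}" unfolding g by (rule generate.incl) simp
    ultimately have "simple_in (F\<lparr>carrier := ?H\<rparr>) ?g"
      using mixed_power_neq_one[OF n] 
      by (intro simple_in_of_free_basis[OF H.group_axioms, of "{?t}" "{?x, ?y}" ?x]) simp_all
    then show ?thesis using S g by simp
  next
    case False
    then obtain k where k: "n = 2 * k" by (auto elim: evenE)
    have "?g = ?x [^] k \<otimes> ?y [^] k" by (simp add: k nat_pow_pow)
    moreover have "?x \<in> generate F {?x, ?y}" "?y \<in> generate F {?x, ?y}" by (auto intro: generate.incl)
    ultimately have g: "?g \<in> generate F {?x, ?y}" using nat_pow_in_generate generate.eng by metis
    have "?S = {?x, ?y} \<union> {?t}" by blast
    then have "free_basis (F\<lparr>carrier := ?H\<rparr>) ({?x, ?y} \<union> {?t})" using basis_H by simp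
    moreover have "{?x, ?y} \<inter> {?t} = {}" using squares_mixed_distinct(2,3)[of m] by simp
    moreover have "?g \<in> generate (F\<lparr>carrier := ?H\<rparr>) {?x, ?y}" using g gen_H[of "{?x, ?y}"] by simp
    ultimately have "simple_in (F\<lparr>carrier := ?H\<rparr>) ?g"
      using mixed_power_neq_one[OF n] 
      by (intro simple_in_of_free_basis[OF H.group_axioms, of "{?x, ?y}" "{?t}" ?t]) simp_all
    moreover have "generate F {?x, ?y} \<subseteq> ?H" by (rule mono_generate) blast
    ultimately show ?thesis using g by blast
  qed
  then show thesis using that[OF H rcosets_squares_mixed[OF m]] by blast
qed

end

theorem theorem1p3:
  fixes F :: "('g, 'm) monoid_scheme" and a b :: 'g and n :: nat
  assumes "group F" and "a \<noteq> b" and "free_basis F {a, b}" and "n \<ge> 2"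
  shows "simplicity_index F (a [^]\<^bsub>F\<^esub> n \<otimes>\<^bsub>F\<^esub> b [^]\<^bsub>F\<^esub> n) = 2"
  unfolding simplicity_index_def
proof (rule Least_equality)
  interpret free_rank_two F a b
    by (intro free_rank_two.intro free_rank_two_axioms.intro assms)
  let ?g = "a [^]\<^bsub>F\<^esub> n \<otimes>\<^bsub>F\<^esub> b [^]\<^bsub>F\<^esub> n"
  have "n > 0" using assms(4) by simp
  then obtain H where "subgroup H F" "finite (rcosets\<^bsub>F\<^esub> H)" "card (rcosets\<^bsub>F\<^esub> H) = 2"
      "?g \<in> H" "simple_in (F\<lparr>carrier := H\<rparr>) ?g"
    by (rule mixed_power_simple_in_index_two)
  then show "\<exists>H. subgroup H F \<and> finite (rcosets\<^bsub>F\<^esub> H) \<and> card (rcosets\<^bsub>F\<^esub> H) = 2 \<and>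
      ?g \<in> H \<and> simple_in (F\<lparr>carrier := H\<rparr>) ?g" by blast
  fix k
  assume "\<exists>H. subgroup H F \<and> finite (rcosets\<^bsub>F\<^esub> H) \<and> card (rcosets\<^bsub>F\<^esub> H) = k \<and>
      ?g \<in> H \<and> simple_in (F\<lparr>carrier := H\<rparr>) ?g"
  then obtain H where H: "subgroup H F" "finite (rcosets\<^bsub>F\<^esub> H)" "card (rcosets\<^bsub>F\<^esub> H) = k"
      "simple_in (F\<lparr>carrier := H\<rparr>) ?g" by blast
  \<comment> \<open>A finite nonempty set of cosets gives a positive index; index one would make
    \<open>H\<close> the whole group, where the element is not simple.\<close>
  have "rcosets\<^bsub>F\<^esub> H \<noteq> {}" by (auto simp: RCOSETS_def)
  then have "k \<noteq> 0" using H by auto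
  moreover have "k \<noteq> 1"
  proof
    assume "k = 1"
    then have "F\<lparr>carrier := H\<rparr> = F" using subgroup_eq_carrier_of_card_rcosets[OF H(1)] H(3) by simp
    then show False using H(4) not_simple_in_free_basis[OF assms] by simp
  qed
  ultimately show "2 \<le> k" by simp
qed

end
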